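(* (a) Let $C\subset\mathbb{H}_n$ be small, $\varphi(\bar x,\bar y)\in\mathcal{L}_0(C)$, and $\bar b$ a tuple of elements of $\mathbb{H}_n\setminus C$ such that $\varphi(\bar x,\bar b)$ is consistent. Then $\varphi(\bar x,\bar b)$ divides over $C$ if and only if either $\varphi(\bar x,\bar b)$ has a conjunct of the form $x_i=b$ for some entry $b$ of $\bar b$, or $\varphi(\bar x,\bar y)\in\mathcal{L}_R(C)$ and $K^\varphi_n(\bar b/C)$. (b) Let $A,B,C\subset\mathbb{H}_n$ be small. Then $A\mathop{\perp\!\!\!\perp}^d_C B$ if and only if (i) $A\cap B\subseteq C$, and (ii) for every tuple $\bar b$ of elements of $B\setminus C$, if $K_n(\bar b/A\cup C)$ then $K_n(\bar b/C)$.
   Context: Fix $n\ge3$; $K_m$ is the complete graph on $m$ vertices. Language $\{R\}$, $R$ the symmetric irreflexive edge relation. $T_n$ is the complete theory of the generic $K_n$-free (Henson) graph: the unique countable $K_n$-free graph into which every finite $K_n$-free graph embeds as an induced subgraph and in which every isomorphism between finite induced subgraphs extends to an automorphism. $\mathbb{H}_n$ is a sufficiently saturated monster model of $T_n$; "$C\subset\mathbb{H}_n$" means $C$ is small. Dividing: a partial type $\pi(\bar x,\bar b)$ divides over $C$ if there is a $C$-indiscernible sequence $(\bar b^l)_{l<\omega}$ with $\bar b^0=\bar b$ such that $\bigcup_l\pi(\bar x,\bar b^l)$ is inconsistent; a formula divides if the type consisting of it does. $A\mathop{\perp\!\!\!\perp}^d_C B$ means $\operatorname{tp}(A/B\cup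 C)$ does not divide over $C$. $\mathcal{L}_0(C)$: conjunctions of atomic and negated atomic formulas with parameters from $C$, no conjunct $x=c$ ($x$ a variable, $c\in C$); for $\varphi(\bar x,\bar y)$ also no conjunct $x_i=x_j$ or $y_i=y_j$ with $i\ne j$; formulas symmetrically closed. "$\varphi(\bar x,\bar b)$ has conjunct $x_i=b$" means $\varphi(\bar x,\bar y)$ has a conjunct $x_i=y_j$ and $b=b_j$. $\mathcal{L}_R(C)$: those $\varphi(\bar x,\bar y)\in\mathcal{L}_0(C)$ with no conjunct $x_i=y_j$. $K_n(B/C)$ (for subsets $B,C$, used for disjoint ones): there is $B_0\subseteq B\cup C$, $|B_0|=n$, $B_0\cap C\ne\emptyset\ne B_0\cap B$, distinct elements of $B_0\cap C$ pairwise adjacent, and every element of $B_0\cap B$ adjacent to every element of $B_0\cap C$. For tuples use their sets of entries. $K^\varphi_n(\bar b/C)$ (for $\varphi\in\mathcal{L}_R(C)$, $\bar b$ from $\mathbb{H}_n\setminus C$, $\varphi(\bar x,\bar b)$ consistent): there is $B\subseteq\bar b$ with $0<|B|<n$ such that $\neg K_n(B/C)$ and $K_n(B/\bar aC)$ for all $\bar a\models\varphi(\bar x,\bar b)$.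
   Formalization: In the definition of K^φ_n(b/C), the condition K_n(B/aC) is read as K_n(B/(a∪C)∖B), so entries of a lying in B are not counted in the base; applied verbatim to non-disjoint sets, the definition makes (a) false (n=3, C empty, an unused variable x_2). *)

theory Defs
  imports Main
begin

unbundle cardinal_syntax

(* First-order formulas in the language of one binary relation. Free symbols (variables and
   parameters) come from an arbitrary type; bound variables are de Bruijn indices. *)

datatype 's tm = Sym 's | Bnd nat

datatype (syms: 's) fm =
    Tru
  | Eq "'s tm" "'s tm"
  | Adj "'s tm" "'s tm"
  | Neg "'s fm"
  | And "'s fm" "'s fm"
  | Exi "'s fm"

primrec wf_tm :: "nat \<Rightarrow> 's tm \<Rightarrow> bool" where
  "wf_tm k (Sym s) = True"
| "wf_tm k (Bnd i) = (i < k)"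

primrec wf_fm :: "nat \<Rightarrow> 's fm \<Rightarrow> bool" where
  "wf_fm k Tru = True"
| "wf_fm k (Eq s t) = (wf_tm k s \<and> wf_tm k t)"
| "wf_fm k (Adj s t) = (wf_tm k s \<and> wf_tm k t)"
| "wf_fm k (Neg \<phi>) = wf_fm k \<phi>"
| "wf_fm k (And \<phi> \<psi>) = (wf_fm k \<phi> \<and> wf_fm k \<psi>)"
| "wf_fm k (Exi \<phi>) = wf_fm (Suc k) \<phi>"

primrec val :: "('s \<Rightarrow> 'a) \<Rightarrow> 'a list \<Rightarrow> 's tm \<Rightarrow> 'a" where
  "val \<rho> e (Sym s) = \<rho> s"
| "val \<rho> e (Bnd i) = e ! i"

(* A structure is a relation R on a type; its universe is the whole type. *)
primrec holds :: "('a \<Rightarrow> 'a \<Rightarrow> bool) \<Rightarrow> ('s \<Rightarrow> 'a) \<Rightarrow> 'a list \<Rightarrow> 's fm \<Rightarrow> bool" where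
  "holds R \<rho> e Tru = True"
| "holds R \<rho> e (Eq s t) = (val \<rho> e s = val \<rho> e t)"
| "holds R \<rho> e (Adj s t) = R (val \<rho> e s) (val \<rho> e t)"
| "holds R \<rho> e (Neg \<phi>) = (\<not> holds R \<rho> e \<phi>)"
| "holds R \<rho> e (And \<phi> \<psi>) = (holds R \<rho> e \<phi> \<and> holds R \<rho> e \<psi>)"
| "holds R \<rho> e (Exi \<phi>) = (\<exists>a. holds R \<rho> (a # e) \<phi>)"

definition true_in :: "('a \<Rightarrow> 'a \<Rightarrow> bool) \<Rightarrow> unit fm \<Rightarrow> bool" where
  "true_in R \<sigma> \<longleftrightarrow> (\<forall>\<rho>. holds R \<rho> [] \<sigma>)"

definition sentences :: "unit fm set" where
  "sentences = {\<sigma>. wf_fm 0 \<sigma> \<and> syms \<sigma> = {}}"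

(* In a formula with parameters, Inl v is a variable and Inr c names the element c. *)

definition lang :: "'v set \<Rightarrow> 'a set \<Rightarrow> ('v + 'a) fm set" where
  "lang V C = {\<phi>. wf_fm 0 \<phi> \<and> syms \<phi> \<subseteq> V <+> C}"

definition models :: "('a \<Rightarrow> 'a \<Rightarrow> bool) \<Rightarrow> ('v \<Rightarrow> 'a) \<Rightarrow> ('v + 'a) fm \<Rightarrow> bool" where
  "models R \<rho> \<phi> \<longleftrightarrow> holds R (case_sum \<rho> id) [] \<phi>"

(* Consistency with the elementary diagram of the structure, i.e. finite satisfiability in it. *)
definition consistent :: "('a \<Rightarrow> 'a \<Rightarrow> bool) \<Rightarrow> ('v + 'a) fm set \<Rightarrow> bool" where
  "consistent R p \<longleftrightarrow> (\<forall>F. finite F \<and> F \<subseteq> p \<longrightarrow> (\<exists>\<rho>. \<forall>\<phi>\<in>F. models R \<rho> \<phi>))"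

definition tp :: "('a \<Rightarrow> 'a \<Rightarrow> bool) \<Rightarrow> 'a set \<Rightarrow> 'a set \<Rightarrow> ('a + 'a) fm set" where
  "tp R A D = {\<phi> \<in> lang A D. models R id \<phi>}"

(* From \<phi>(x,y), with x-variables Inl (Inl i), y-variables Inl (Inr j) and parameters Inr c,
   to \<phi>(x,b): each y-variable j is replaced by the parameter b j. *)
definition inst :: "('j \<Rightarrow> 'a) \<Rightarrow> (('i + 'j) + 'a) fm \<Rightarrow> ('i + 'a) fm" where
  "inst b = map_fm (case_sum (case_sum Inl (\<lambda>j. Inr (b j))) Inr)"

definition graph :: "('a \<Rightarrow> 'a \<Rightarrow> bool) \<Rightarrow> bool" where
  "graph R \<longleftrightarrow> (\<forall>u v. R u v \<longrightarrow> R v u) \<and> (\<forall>u. \<not> R u u)"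

definition clique_free :: "nat \<Rightarrow> 'a set \<Rightarrow> ('a \<Rightarrow> 'a \<Rightarrow> bool) \<Rightarrow> bool" where
  "clique_free n V R \<longleftrightarrow>
     \<not> (\<exists>S\<subseteq>V. finite S \<and> card S = n \<and> (\<forall>u\<in>S. \<forall>v\<in>S. u \<noteq> v \<longrightarrow> R u v))"

definition henson_graph :: "nat \<Rightarrow> (nat \<Rightarrow> nat \<Rightarrow> bool) \<Rightarrow> bool" where
  "henson_graph n G \<longleftrightarrow>
     graph G \<and> clique_free n UNIV G \<and>
     (\<forall>(V :: nat set) D. finite V \<and> graph D \<and> clique_free n V D \<longrightarrow>
        (\<exists>f. inj_on f V \<and> (\<forall>u\<in>V. \<forall>v\<in>V. D u v \<longleftrightarrow> G (f u) (f v)))) \<and>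
     (\<forall>V f. finite V \<and> inj_on f V \<and> (\<forall>u\<in>V. \<forall>v\<in>V. G u v \<longleftrightarrow> G (f u) (f v)) \<longrightarrow>
        (\<exists>g. bij g \<and> (\<forall>u v. G u v \<longleftrightarrow> G (g u) (g v)) \<and> (\<forall>u\<in>V. g u = f u)))"

(* Countable Henson graphs are infinite, hence copied onto nat, and unique up to isomorphism,
   so this is the complete theory of any one of them. *)
definition henson_theory :: "nat \<Rightarrow> unit fm set" where
  "henson_theory n = {\<sigma> \<in> sentences. \<forall>G. henson_graph n G \<longrightarrow> true_in G \<sigma>}"

definition small :: "'k rel \<Rightarrow> 'a set \<Rightarrow> bool" where
  "small \<kappa> C \<longleftrightarrow> |C| <o \<kappa>"

definition saturated :: "'k rel \<Rightarrow> ('a \<Rightarrow> 'a \<Rightarrow> bool) \<Rightarrow> bool" where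
  "saturated \<kappa> R \<longleftrightarrow>
     (\<forall>D (p :: (unit + 'a) fm set). small \<kappa> D \<and> p \<subseteq> lang UNIV D \<and> consistent R p \<longrightarrow>
        (\<exists>\<rho>. \<forall>\<phi>\<in>p. models R \<rho> \<phi>))"

definition henson_monster :: "nat \<Rightarrow> 'k rel \<Rightarrow> ('a \<Rightarrow> 'a \<Rightarrow> bool) \<Rightarrow> bool" where
  "henson_monster n \<kappa> R \<longleftrightarrow>
     Card_order \<kappa> \<and> natLeq <o \<kappa> \<and> (\<forall>\<sigma>\<in>henson_theory n. true_in R \<sigma>) \<and> saturated \<kappa> R"

(* s l is the l-th tuple, indexed by J; in a formula, (i, j) is the j-th entry of the i-th of the
   chosen tuples. *)
definition indiscernible ::
  "('a \<Rightarrow> 'a \<Rightarrow> bool) \<Rightarrow> 'a set \<Rightarrow> 'j set \<Rightarrow> (nat \<Rightarrow> 'j \<Rightarrow> 'a) \<Rightarrow> bool" where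
  "indiscernible R C J s \<longleftrightarrow>
     (\<forall>\<phi> \<in> lang (UNIV \<times> J) C. \<forall>g h :: nat \<Rightarrow> nat. strict_mono g \<and> strict_mono h \<longrightarrow>
        (models R (\<lambda>(i, j). s (g i) j) \<phi> \<longleftrightarrow> models R (\<lambda>(i, j). s (h i) j) \<phi>))"

(* divides R C J \<pi> b: the partial type \<pi>(x,b) divides over C, for a set \<pi>(x,y) of formulas
   over C and a tuple b indexed by J. *)
definition divides ::
  "('a \<Rightarrow> 'a \<Rightarrow> bool) \<Rightarrow> 'a set \<Rightarrow> 'j set \<Rightarrow> (('i + 'j) + 'a) fm set \<Rightarrow> ('j \<Rightarrow> 'a) \<Rightarrow> bool" where
  "divides R C J \<pi> b \<longleftrightarrow>
     (\<exists>s. indiscernible R C J s \<and> (\<forall>j\<in>J. s 0 j = b j) \<and>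
          \<not> consistent R (\<Union>l. inst (s l) ` \<pi>))"

(* A and B \<union> C are enumerated by themselves, so that the instances of the set below at the
   tuple id are exactly the members of tp(A / B \<union> C). *)
definition indep_d ::
  "('a \<Rightarrow> 'a \<Rightarrow> bool) \<Rightarrow> 'a set \<Rightarrow> 'a set \<Rightarrow> 'a set \<Rightarrow> bool" where
  "indep_d R A C B \<longleftrightarrow>
     \<not> divides R C (B \<union> C) {\<phi> \<in> lang (A <+> (B \<union> C)) {}. inst id \<phi> \<in> tp R A (B \<union> C)} id"

primrec conjuncts :: "'s fm \<Rightarrow> 's fm set" where
  "conjuncts Tru = {}"
| "conjuncts (Eq s t) = {Eq s t}"
| "conjuncts (Adj s t) = {Adj s t}"
| "conjuncts (Neg \<phi>) = {Neg \<phi>}"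
| "conjuncts (And \<phi> \<psi>) = conjuncts \<phi> \<union> conjuncts \<psi>"
| "conjuncts (Exi \<phi>) = {Exi \<phi>}"

definition literal :: "'s fm \<Rightarrow> bool" where
  "literal \<phi> \<longleftrightarrow>
     (\<exists>s t. \<phi> = Eq s t \<or> \<phi> = Adj s t \<or> \<phi> = Neg (Eq s t) \<or> \<phi> = Neg (Adj s t))"

definition sym_closed :: "'s fm \<Rightarrow> bool" where
  "sym_closed \<phi> \<longleftrightarrow>
     (\<forall>s t. (Eq s t \<in> conjuncts \<phi> \<longrightarrow> Eq t s \<in> conjuncts \<phi>) \<and>
            (Adj s t \<in> conjuncts \<phi> \<longrightarrow> Adj t s \<in> conjuncts \<phi>) \<and>
            (Neg (Eq s t) \<in> conjuncts \<phi> \<longrightarrow> Neg (Eq t s) \<in> conjuncts \<phi>) \<and>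
            (Neg (Adj s t) \<in> conjuncts \<phi> \<longrightarrow> Neg (Adj t s) \<in> conjuncts \<phi>))"

abbreviation xvar :: "nat \<Rightarrow> ((nat + nat) + 'a) tm" where
  "xvar i \<equiv> Sym (Inl (Inl i))"

abbreviation yvar :: "nat \<Rightarrow> ((nat + nat) + 'a) tm" where
  "yvar j \<equiv> Sym (Inl (Inr j))"

(* Formulas \<phi>(x,y) in tuples x of length k and y of length m. *)
definition L0 :: "nat \<Rightarrow> nat \<Rightarrow> 'a set \<Rightarrow> ((nat + nat) + 'a) fm set" where
  "L0 k m C = {\<phi> \<in> lang ({..<k} <+> {..<m}) C.
     (\<forall>\<psi>\<in>conjuncts \<phi>. literal \<psi>) \<and>
     (\<forall>v c. Eq (Sym (Inl v)) (Sym (Inr c)) \<notin> conjuncts \<phi>) \<and>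
     (\<forall>i j. i \<noteq> j \<longrightarrow> Eq (xvar i) (xvar j) \<notin> conjuncts \<phi> \<and>
                     Eq (yvar i) (yvar j) \<notin> conjuncts \<phi>) \<and>
     sym_closed \<phi>}"

definition LR :: "nat \<Rightarrow> nat \<Rightarrow> 'a set \<Rightarrow> ((nat + nat) + 'a) fm set" where
  "LR k m C = {\<phi> \<in> L0 k m C. \<forall>i j. Eq (xvar i) (yvar j) \<notin> conjuncts \<phi>}"

definition has_conjunct_eq :: "((nat + nat) + 'a) fm \<Rightarrow> 'a list \<Rightarrow> nat \<Rightarrow> 'a \<Rightarrow> bool" where
  "has_conjunct_eq \<phi> bs i b \<longleftrightarrow>
     (\<exists>j<length bs. Eq (xvar i) (yvar j) \<in> conjuncts \<phi> \<and> b = bs ! j)"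

definition Kn :: "('a \<Rightarrow> 'a \<Rightarrow> bool) \<Rightarrow> nat \<Rightarrow> 'a set \<Rightarrow> 'a set \<Rightarrow> bool" where
  "Kn R n B C \<longleftrightarrow>
     (\<exists>B0\<subseteq>B \<union> C. finite B0 \<and> card B0 = n \<and> B0 \<inter> C \<noteq> {} \<and> B0 \<inter> B \<noteq> {} \<and>
        (\<forall>u \<in> B0 \<inter> C. \<forall>v \<in> B0 \<inter> C. u \<noteq> v \<longrightarrow> R u v) \<and>
        (\<forall>u \<in> B0 \<inter> B. \<forall>v \<in> B0 \<inter> C. R u v))"

(* A realization as may meet B; since Kn is a relation between disjoint sets, such common
   elements are counted on the side of B only. (Without this, an x-variable not occurring in \<phi>
   could be assigned an element of B and would spoil Kn.) *)
definition Kn_phi ::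
  "('a \<Rightarrow> 'a \<Rightarrow> bool) \<Rightarrow> nat \<Rightarrow> nat \<Rightarrow> ((nat + nat) + 'a) fm \<Rightarrow> 'a list \<Rightarrow> 'a set \<Rightarrow> bool" where
  "Kn_phi R n k \<phi> bs C \<longleftrightarrow>
     (\<exists>B\<subseteq>set bs. 0 < card B \<and> card B < n \<and> \<not> Kn R n B C \<and>
        (\<forall>as. length as = k \<and> models R (nth as) (inst (nth bs) \<phi>) \<longrightarrow>
           Kn R n B ((set as \<union> C) - B)))"

end

theory Submission
  imports Defs
begin

text \<open>
  By saturation, every small clique-free graph extending a small part of the monster embeds over
  that part; in particular finite partial isomorphisms preserve all formulas, so that only edges and
  equalities matter for indiscernibility.

  In an indiscernible sequence corresponding points of two members are not adjacent, for otherwise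
  they would form an infinite clique. A clique in the union of the sequence, \<open>C\<close> and a new tuple
  joined to all members alike therefore projects injectively to the first member, where it witnesses
  \<open>K\<^sub>n(X/AC)\<close> for a finite \<open>X\<close>; if this implies \<open>K\<^sub>n(X/C)\<close>, there is already such a clique in the
  monster. Conversely, if \<open>K\<^sub>n(X/AC)\<close> but not \<open>K\<^sub>n(X/C)\<close>, one can spread \<open>X\<close> over an
  indiscernible sequence in which the transversals of \<open>X\<close> are cliques, and the type of \<open>A\<close> cannot be
  realized over all members at once.
\<close>

section \<open>Cliques and embeddings\<close>

lemma clique_free_iff: "clique_free n V R \<longleftrightarrow> \<not> (\<exists>S\<subseteq>V. finite S \<and> card S = n \<and> pairwise R S)"
  by (simp add: clique_free_def pairwise_def)

lemma clique_free_subset: "clique_free n V R \<Longrightarrow> W \<subseteq> V \<Longrightarrow> clique_free n W R"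
  by (auto simp: clique_free_iff)

lemma clique_image: "pairwise (\<lambda>u v. R (f u) (f v)) S \<Longrightarrow> pairwise R (f ` S)"
  by (auto simp: pairwise_image pairwise_def)

lemma inj_on_if_clique_image:
  assumes "pairwise (\<lambda>u v. R (f u) (f v)) S" "\<And>x. \<not> R x x"
  shows "inj_on f S"
  using assms by (metis inj_onI pairwiseD)

definition embedding :: "('v \<Rightarrow> 'v \<Rightarrow> bool) \<Rightarrow> ('a \<Rightarrow> 'a \<Rightarrow> bool) \<Rightarrow> 'v set \<Rightarrow> ('v \<Rightarrow> 'a) \<Rightarrow> bool" where
  "embedding E R V f \<longleftrightarrow> inj_on f V \<and> (\<forall>u\<in>V. \<forall>v\<in>V. E u v \<longleftrightarrow> R (f u) (f v))"

lemma embeddingD: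
  assumes "embedding E R V f" "u \<in> V" "v \<in> V"
  shows embedding_eq_iff: "f u = f v \<longleftrightarrow> u = v" and embedding_adj_iff: "R (f u) (f v) \<longleftrightarrow> E u v"
  using assms by (auto simp: embedding_def inj_on_eq_iff)

lemma embedding_subset: "embedding E R V f \<Longrightarrow> W \<subseteq> V \<Longrightarrow> embedding E R W f"
  by (auto simp: embedding_def intro: inj_on_subset)

lemma embedding_comp:
  "embedding E G V f \<Longrightarrow> embedding G R (f ` V) g \<Longrightarrow> embedding E R V (g \<circ> f)"
  by (simp add: embedding_def comp_inj_on)

lemma clique_free_embedding_image:
  assumes f: "embedding E R V f" and free: "clique_free n V E"
  shows "clique_free n (f ` V) R"
  unfolding clique_free_iff
proof (intro notI, elim exE conjE)
  fix S assume S: "S \<subseteq> f ` V" "finite S" "card S = n" "pairwise R S"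
  then obtain W where W: "W \<subseteq> V" "inj_on f W" "S = f ` W" by (auto simp: subset_image_inj)
  have "pairwise E W"
  proof (rule pairwiseI)
    fix u v assume uv: "u \<in> W" "v \<in> W" "u \<noteq> v"
    then have "f u \<noteq> f v" using W(2) by (simp add: inj_on_eq_iff)
    then have "R (f u) (f v)" using S(4) W(3) uv by (simp add: pairwise_def)
    then show "E u v" using embedding_adj_iff[OF f] W(1) uv by (simp add: subset_iff)
  qed
  moreover have "finite W" "card W = n" using S W(2,3) by (auto simp: card_image finite_image_iff)
  ultimately show False using free W(1) by (auto simp: clique_free_iff)
qed

definition partial_iso :: "('v \<Rightarrow> 'v \<Rightarrow> bool) \<Rightarrow> ('a \<Rightarrow> 'a \<Rightarrow> bool) \<Rightarrow> ('v \<times> 'a) set \<Rightarrow> bool" where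
  "partial_iso E R P \<longleftrightarrow>
     (\<forall>u x v y. (u, x) \<in> P \<longrightarrow> (v, y) \<in> P \<longrightarrow> (u = v \<longleftrightarrow> x = y) \<and> (E u v \<longleftrightarrow> R x y))"

lemma partial_isoD:
  assumes "partial_iso E R P" "(u, x) \<in> P" "(v, y) \<in> P"
  shows "u = v \<longleftrightarrow> x = y" "E u v \<longleftrightarrow> R x y"
  using assms unfolding partial_iso_def by blast+

lemma partial_iso_subset: "partial_iso E R P \<Longrightarrow> Q \<subseteq> P \<Longrightarrow> partial_iso E R Q"
  unfolding partial_iso_def by blast

lemma partial_iso_converse: "partial_iso E R P \<Longrightarrow> partial_iso R E (P\<inverse>)"
  unfolding partial_iso_def by blast

lemma partial_iso_image_iff:
  "partial_iso E R ((\<lambda>s. (\<sigma> s, \<tau> s)) ` S) \<longleftrightarrow>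
     (\<forall>s\<in>S. \<forall>t\<in>S. (\<sigma> s = \<sigma> t \<longleftrightarrow> \<tau> s = \<tau> t) \<and> (E (\<sigma> s) (\<sigma> t) \<longleftrightarrow> R (\<tau> s) (\<tau> t)))"
  unfolding partial_iso_def by blast

lemma partial_iso_graph_iff: "partial_iso E R ((\<lambda>v. (v, f v)) ` V) \<longleftrightarrow> embedding E R V f"
  by (auto simp: partial_iso_image_iff embedding_def inj_on_def)

lemma partial_iso_domain_embedding:
  assumes f: "embedding E G V f" and P: "partial_iso E R P" and dom: "Domain P \<subseteq> V"
  shows "partial_iso G R ((\<lambda>(u, x). (f u, x)) ` P)"
proof -
  have "(f u = f v \<longleftrightarrow> x = y) \<and> (G (f u) (f v) \<longleftrightarrow> R x y)" if "(u, x) \<in> P" "(v, y) \<in> P" for u x v y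
  proof -
    have "u \<in> V" "v \<in> V" using that dom by auto
    then show ?thesis using partial_isoD[OF P that] embeddingD[OF f] by simp
  qed
  then show ?thesis by (auto simp: partial_iso_def)
qed

lemma partial_iso_insertI:
  assumes "graph E" "graph R" and P: "partial_iso E R P"
    and new: "\<And>u x. (u, x) \<in> P \<Longrightarrow> (v = u \<longleftrightarrow> y = x) \<and> (E v u \<longleftrightarrow> R y x)"
  shows "partial_iso E R (insert (v, y) P)"
proof -
  have "(u = v \<longleftrightarrow> x = y) \<and> (E u v \<longleftrightarrow> R x y)" if "(u, x) \<in> P" for u x
    using new[OF that] assms(1,2) unfolding graph_def by blast
  moreover have "\<not> E v v" "\<not> R y y" using assms(1,2) by (simp_all add: graph_def)
  ultimately show ?thesis
    using P new unfolding partial_iso_def insert_iff prod.inject by blast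
qed

lemma partial_iso_Union_chain:
  assumes "\<And>P. P \<in> \<C> \<Longrightarrow> partial_iso E R P" "\<And>P Q. P \<in> \<C> \<Longrightarrow> Q \<in> \<C> \<Longrightarrow> P \<subseteq> Q \<or> Q \<subseteq> P"
  shows "partial_iso E R (\<Union>\<C>)"
proof -
  have "(u = v \<longleftrightarrow> x = y) \<and> (E u v \<longleftrightarrow> R x y)"
    if pairs: "(u, x) \<in> \<Union>\<C>" "(v, y) \<in> \<Union>\<C>" for u x v y
  proof -
    obtain P Q where "P \<in> \<C>" "(u, x) \<in> P" "Q \<in> \<C>" "(v, y) \<in> Q" using pairs by blast
    then have "\<exists>P\<in>\<C>. (u, x) \<in> P \<and> (v, y) \<in> P" using assms(2)[of P Q] by blast
    then show ?thesis using partial_isoD[OF assms(1)] by metis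
  qed
  then show ?thesis by (auto simp: partial_iso_def)
qed

lemma partial_iso_graphE:
  assumes "partial_iso E R P"
  obtains f where "P = (\<lambda>v. (v, f v)) ` Domain P"
proof -
  have "\<exists>f. \<forall>v. v \<in> Domain P \<longrightarrow> (v, f v) \<in> P" by (rule choice) blast
  then obtain f where "\<And>v. v \<in> Domain P \<Longrightarrow> (v, f v) \<in> P" by blast
  moreover from this have "x = f v" if "(v, x) \<in> P" for v x
    using partial_isoD(1)[OF assms that] that by blast
  ultimately have "P = (\<lambda>v. (v, f v)) ` Domain P" by (auto simp: image_iff)
  then show thesis by (rule that)
qed

lemma maximal_partial_iso_exists:
  assumes P: "partial_iso E R P" "Domain P \<subseteq> V"
  obtains M where "partial_iso E R M" "Domain M \<subseteq> V" "P \<subseteq> M"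
    "\<And>v y. v \<in> V \<Longrightarrow> partial_iso E R (insert (v, y) M) \<Longrightarrow> (v, y) \<in> M"
proof -
  define Z where "Z = {Q. partial_iso E R Q \<and> Domain Q \<subseteq> V \<and> P \<subseteq> Q}"
  have "\<exists>M\<in>Z. \<forall>Q\<in>Z. M \<subseteq> Q \<longrightarrow> Q = M"
  proof (rule subset_Zorn_nonempty)
    show "Z \<noteq> {}" using P by (auto simp: Z_def)
    fix \<C> assume \<C>: "\<C> \<noteq> {}" "subset.chain Z \<C>"
    then have in_Z: "Q \<in> Z" and nested: "Q \<subseteq> Q' \<or> Q' \<subseteq> Q" if "Q \<in> \<C>" "Q' \<in> \<C>" for Q Q'
      using that by (auto simp: subset.chain_def)
    then have "partial_iso E R (\<Union>\<C>)" by (intro partial_iso_Union_chain) (auto simp: Z_def)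
    moreover have "Q \<in> Z" if "Q \<in> \<C>" for Q using in_Z that by blast
    ultimately show "\<Union>\<C> \<in> Z" using \<C>(1) unfolding Z_def by fast
  qed
  then obtain M where M: "partial_iso E R M" "Domain M \<subseteq> V" "P \<subseteq> M"
    and maximal: "\<And>Q. Q \<in> Z \<Longrightarrow> M \<subseteq> Q \<Longrightarrow> Q = M"
    unfolding Z_def by auto
  have "(v, y) \<in> M" if "v \<in> V" "partial_iso E R (insert (v, y) M)" for v y
    using maximal[of "insert (v, y) M"] that M(2,3) by (auto simp: Z_def)
  with M show thesis by (rule that)
qed

section \<open>Axioms of the Henson graphs\<close>

primrec conj_list :: "'s fm list \<Rightarrow> 's fm" where
  "conj_list [] = Tru"
| "conj_list (\<phi> # \<phi>s) = And \<phi> (conj_list \<phi>s)"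

lemma holds_conj_list: "holds R \<rho> e (conj_list \<phi>s) \<longleftrightarrow> (\<forall>\<phi>\<in>set \<phi>s. holds R \<rho> e \<phi>)"
  by (induction \<phi>s) auto

lemma wf_fm_conj_list: "wf_fm k (conj_list \<phi>s) \<longleftrightarrow> (\<forall>\<phi>\<in>set \<phi>s. wf_fm k \<phi>)"
  by (induction \<phi>s) auto

lemma syms_conj_list: "syms (conj_list \<phi>s) = (\<Union>\<phi>\<in>set \<phi>s. syms \<phi>)"
  by (induction \<phi>s) auto

lemma holds_Exi_pow:
  "holds R \<rho> e ((Exi ^^ p) \<phi>) \<longleftrightarrow> (\<exists>e'. length e' = p \<and> holds R \<rho> (e' @ e) \<phi>)"
proof (induction p arbitrary: e)
  case (Suc p)
  have "(\<exists>a e'. length e' = p \<and> holds R \<rho> ((e' @ [a]) @ e) \<phi>) \<longleftrightarrow>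
    (\<exists>e''. length e'' = Suc p \<and> holds R \<rho> (e'' @ e) \<phi>)"
    by (metis length_Suc_conv_rev length_append_singleton)
  then show ?case by (simp add: Suc.IH)
qed simp

lemma wf_fm_Exi_pow: "wf_fm k ((Exi ^^ p) \<phi>) \<longleftrightarrow> wf_fm (p + k) \<phi>"
  by (induction p arbitrary: k) auto

lemma syms_Exi_pow: "syms ((Exi ^^ p) \<phi>) = syms \<phi>"
  by (induction p) auto

definition signed :: "bool \<Rightarrow> 's fm \<Rightarrow> 's fm" where
  "signed b \<phi> = (if b then \<phi> else Neg \<phi>)"

lemma signed_simps [simp]:
  "holds R \<rho> e (signed b \<phi>) \<longleftrightarrow> (holds R \<rho> e \<phi> \<longleftrightarrow> b)"
  "wf_fm k (signed b \<phi>) \<longleftrightarrow> wf_fm k \<phi>"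
  "syms (signed b \<phi>) = syms \<phi>"
  by (auto simp: signed_def)

definition diagram :: "('v \<Rightarrow> 'v \<Rightarrow> bool) \<Rightarrow> 'v list \<Rightarrow> 's fm" where
  "diagram E ds = conj_list (map (\<lambda>(i, j).
     And (signed (ds ! i = ds ! j) (Eq (Bnd i) (Bnd j)))
         (signed (E (ds ! i) (ds ! j)) (Adj (Bnd i) (Bnd j))))
     (List.product [0..<length ds] [0..<length ds]))"

lemma holds_diagram:
  assumes "length es = length ds"
  shows "holds G \<rho> es (diagram E ds) \<longleftrightarrow> partial_iso E G (set (zip ds es))"
proof -
  have "set (zip ds es) = (\<lambda>i. (ds ! i, es ! i)) ` {..<length ds}"
    using assms by (auto simp: set_zip)
  then show ?thesis
    by (auto simp: diagram_def holds_conj_list partial_iso_image_iff)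
qed

lemma wf_fm_diagram: "wf_fm (length ds) (diagram E ds)"
  by (auto simp: diagram_def wf_fm_conj_list)

lemma syms_diagram: "syms (diagram E ds) = {}"
  by (auto simp: diagram_def syms_conj_list)

definition extension_sentence :: "('v \<Rightarrow> 'v \<Rightarrow> bool) \<Rightarrow> 'v list \<Rightarrow> 'v \<Rightarrow> unit fm" where
  "extension_sentence E ds z =
     Neg ((Exi ^^ length ds) (And (diagram E ds) (Neg (Exi (diagram E (z # ds))))))"

lemma true_in_extension_sentence:
  "true_in G (extension_sentence E ds z) \<longleftrightarrow>
     (\<forall>es. length es = length ds \<longrightarrow> partial_iso E G (set (zip ds es)) \<longrightarrow>
       (\<exists>y. partial_iso E G (insert (z, y) (set (zip ds es)))))"
  by (auto simp: true_in_def extension_sentence_def holds_Exi_pow holds_diagram)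

definition clique_free_sentence :: "nat \<Rightarrow> unit fm" where
  "clique_free_sentence n = Neg ((Exi ^^ n) (diagram (\<noteq>) [0..<n]))"

lemma clique_iff_diagram:
  assumes irrefl: "\<And>x. \<not> R x x"
  shows "(\<exists>S. finite S \<and> card S = n \<and> pairwise R S) \<longleftrightarrow>
    (\<exists>es. length es = n \<and> partial_iso (\<noteq>) R (set (zip [0..<n] es)))"
proof -
  have "partial_iso (\<noteq>) R (set (zip [0..<n] es)) \<longleftrightarrow> distinct es \<and> pairwise R (set es)"
    if len: "length es = n" for es
  proof -
    have "set (zip [0..<n] es) = (\<lambda>i. (i, es ! i)) ` {..<n}" "set es = (!) es ` {..<n}"
      using len by (force simp: set_zip in_set_conv_nth)+
    moreover have "(i = j \<longleftrightarrow> es ! i = es ! j) \<and> (i \<noteq> j \<longleftrightarrow> R (es ! i) (es ! j)) \<longleftrightarrow>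
      (i \<noteq> j \<longrightarrow> es ! i \<noteq> es ! j) \<and> (es ! i \<noteq> es ! j \<longrightarrow> R (es ! i) (es ! j))" for i j
      using irrefl by metis
    ultimately show ?thesis
      using len
      by (simp only: partial_iso_image_iff distinct_conv_nth pairwise_image pairwise_def Ball_def
          lessThan_iff) blast
  qed
  then show ?thesis
    by (metis List.finite_set distinct_card finite_distinct_list)
qed

lemma true_in_clique_free_sentence:
  assumes "\<And>x. \<not> R x x"
  shows "true_in R (clique_free_sentence n) \<longleftrightarrow> clique_free n UNIV R"
  using clique_iff_diagram[of R n, OF assms]
  by (auto simp: true_in_def clique_free_sentence_def holds_Exi_pow holds_diagram clique_free_iff)

definition symmetric_sentence :: "unit fm" where
  "symmetric_sentence = Neg (Exi (Exi (And (Adj (Bnd 0) (Bnd 1)) (Neg (Adj (Bnd 1) (Bnd 0))))))"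

definition irreflexive_sentence :: "unit fm" where
  "irreflexive_sentence = Neg (Exi (Adj (Bnd 0) (Bnd 0)))"

lemma true_in_graph_sentences:
  "true_in R symmetric_sentence \<and> true_in R irreflexive_sentence \<longleftrightarrow> graph R"
  by (auto simp: true_in_def symmetric_sentence_def irreflexive_sentence_def graph_def)

lemma axioms_are_sentences:
  "extension_sentence E ds z \<in> sentences" "clique_free_sentence n \<in> sentences"
  "symmetric_sentence \<in> sentences" "irreflexive_sentence \<in> sentences"
  using wf_fm_diagram[of ds E] wf_fm_diagram[of "z # ds" E] wf_fm_diagram[of "[0..<n]" "(\<noteq>)"]
  by (auto simp: sentences_def extension_sentence_def clique_free_sentence_def
      symmetric_sentence_def irreflexive_sentence_def wf_fm_Exi_pow syms_Exi_pow syms_diagram)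

lemma henson_graph_iff_embedding:
  "henson_graph n G \<longleftrightarrow> graph G \<and> clique_free n UNIV G \<and>
     (\<forall>(V :: nat set) E. finite V \<and> graph E \<and> clique_free n V E \<longrightarrow> (\<exists>f. embedding E G V f)) \<and>
     (\<forall>V f. finite V \<and> embedding G G V f \<longrightarrow>
        (\<exists>g. bij g \<and> embedding G G UNIV g \<and> (\<forall>u\<in>V. g u = f u)))"
  by (simp add: henson_graph_def embedding_def bij_def conj_ac cong: conj_cong)

lemma henson_graph_universal:
  fixes E :: "'v \<Rightarrow> 'v \<Rightarrow> bool"
  assumes G: "henson_graph n G" and V: "finite V" and E: "graph E" "clique_free n V E"
  shows "\<exists>f. embedding E G V f"
proof -
  obtain h :: "'v \<Rightarrow> nat" where h: "inj_on h V" using finite_imp_inj_to_nat_seg[OF V] by blast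
  define E' where "E' i j \<longleftrightarrow> E (inv_into V h i) (inv_into V h j)" for i j
  have iso: "embedding E E' V h" using h by (simp add: embedding_def E'_def)
  have "graph E'" using E(1) by (auto simp: graph_def E'_def)
  moreover have "clique_free n (h ` V) E'" using iso E(2) by (rule clique_free_embedding_image)
  ultimately have "\<exists>g. embedding E' G (h ` V) g"
    using G V by (simp add: henson_graph_iff_embedding)
  then show ?thesis using embedding_comp[OF iso] by blast
qed

lemma henson_graph_homogeneous:
  assumes G: "henson_graph n G" and P: "finite P" "partial_iso G G P"
  obtains g where "embedding G G UNIV g" "\<And>x y. (x, y) \<in> P \<Longrightarrow> g x = y"
proof -
  obtain f where f: "P = (\<lambda>v. (v, f v)) ` Domain P" using partial_iso_graphE[OF P(2)] .
  then have "embedding G G (Domain P) f" using P(2) partial_iso_graph_iff by metis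
  then have "\<exists>g. bij g \<and> embedding G G UNIV g \<and> (\<forall>u\<in>Domain P. g u = f u)"
    using G finite_Domain[OF P(1)] by (simp add: henson_graph_iff_embedding)
  then obtain g where g: "embedding G G UNIV g" "\<forall>u\<in>Domain P. g u = f u" by blast
  moreover have "g x = y" if "(x, y) \<in> P" for x y using g(2) that by (subst (asm) f) auto
  ultimately show thesis using that by blast
qed

lemma extension_sentence_in_henson_theory:
  assumes E: "graph E" "clique_free n (insert z (set ds)) E"
  shows "extension_sentence E ds z \<in> henson_theory n"
proof -
  have "\<exists>y. partial_iso E G (insert (z, y) (set (zip ds es)))"
    if G: "henson_graph n G" and P: "partial_iso E G (set (zip ds es))" for G es
  proof -
    let ?V = "insert z (set ds)" and ?P = "set (zip ds es)"
    obtain f where f: "embedding E G ?V f" using henson_graph_universal[OF G _ E] by blast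
    have dom: "u \<in> ?V" if "(u, x) \<in> ?P" for u x using that by (auto dest: set_zip_leftD)
    have "partial_iso G G ((\<lambda>(u, x). (f u, x)) ` ?P)"
      using P by (rule partial_iso_domain_embedding[OF f]) (use dom in blast)
    then obtain g where g: "embedding G G UNIV g" "\<And>u x. (u, x) \<in> ?P \<Longrightarrow> g (f u) = x"
      by (rule henson_graph_homogeneous[OF G, rotated]) force+
    have "embedding G G (f ` ?V) g" using g(1) by (rule embedding_subset) simp
    then have "embedding E G ?V (g \<circ> f)" using f embedding_comp by blast
    then have "partial_iso E G ((\<lambda>v. (v, (g \<circ> f) v)) ` ?V)"
      unfolding partial_iso_graph_iff .
    moreover have "insert (z, g (f z)) ?P \<subseteq> (\<lambda>v. (v, (g \<circ> f) v)) ` ?V" using g(2) dom by force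
    ultimately show ?thesis using partial_iso_subset by blast
  qed
  then show ?thesis
    by (auto simp: henson_theory_def true_in_extension_sentence axioms_are_sentences)
qed

lemma graph_sentences_in_henson_theory:
  "{symmetric_sentence, irreflexive_sentence, clique_free_sentence n} \<subseteq> henson_theory n"
proof -
  have "true_in G symmetric_sentence" "true_in G irreflexive_sentence"
    "true_in G (clique_free_sentence n)" if "henson_graph n G" for G
  proof -
    have G: "graph G" "clique_free n UNIV G" using that by (simp_all add: henson_graph_def)
    then show "true_in G symmetric_sentence" "true_in G irreflexive_sentence"
      using true_in_graph_sentences by blast+
    show "true_in G (clique_free_sentence n)"
      using G by (subst true_in_clique_free_sentence) (simp_all add: graph_def)
  qed
  then show ?thesis by (simp add: henson_theory_def axioms_are_sentences)
qed

section \<open>Small extensions in saturated models\<close>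

lemma small_subset: "small \<kappa> B \<Longrightarrow> A \<subseteq> B \<Longrightarrow> small \<kappa> A"
  unfolding small_def using card_of_mono1 ordLeq_ordLess_trans by blast

lemma small_image: "small \<kappa> A \<Longrightarrow> small \<kappa> (f ` A)"
  unfolding small_def using card_of_image ordLeq_ordLess_trans by blast

locale uncountable_cardinal =
  fixes \<kappa> :: "'k rel"
  assumes Card_order: "Card_order \<kappa>" and uncountable: "natLeq <o \<kappa>"
begin

lemma infinite_Field: "infinite (Field \<kappa>)"
  using uncountable Card_order
  by (metis cinfinite_def cinfinite_mono natLeq_cinfinite ordLess_imp_ordLeq)

lemma small_finite: "finite A \<Longrightarrow> small \<kappa> A"
  unfolding small_def using uncountable finite_iff_ordLess_natLeq ordLess_transitive by blast

lemma small_Un: "small \<kappa> A \<Longrightarrow> small \<kappa> B \<Longrightarrow> small \<kappa> (A \<union> B)"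
  unfolding small_def using card_of_Un_ordLess_infinite_Field infinite_Field Card_order by blast

lemma small_nat_Times:
  assumes B: "small \<kappa> B"
  shows "small \<kappa> ((UNIV :: nat set) \<times> B)"
proof -
  let ?W = "(UNIV :: nat set) <+> B"
  have "small \<kappa> (UNIV :: nat set)"
    unfolding small_def using uncountable card_of_nat ordIso_ordLess_trans by blast
  then have "small \<kappa> ?W"
    using B infinite_Field Card_order card_of_Plus_ordLess_infinite_Field
    unfolding small_def by blast
  moreover have "|(UNIV :: nat set) \<times> B| \<le>o |?W|"
    by (intro card_of_Sigma_ordLeq_infinite ballI card_of_Plus1 card_of_Plus2) simp
  ultimately show ?thesis unfolding small_def using ordLeq_ordLess_trans by blast
qed

lemma small_UN_nat:
  assumes "small \<kappa> B"
  shows "small \<kappa> (\<Union>l :: nat. s l ` B)"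
proof -
  have "(\<Union>l :: nat. s l ` B) = (\<lambda>(l, b). s l b) ` (UNIV \<times> B)" by auto
  then show ?thesis using small_image[OF small_nat_Times[OF assms]] by simp
qed

end

locale clique_free_graph =
  fixes n :: nat and R :: "'a \<Rightarrow> 'a \<Rightarrow> bool"
  assumes graph: "graph R" and clique_free: "clique_free n UNIV R"
begin

lemma adj_sym: "R u v \<Longrightarrow> R v u" and adj_irrefl: "\<not> R u u"
  using graph by (auto simp: graph_def)

lemma not_clique_image:
  assumes "finite S" "card S = n"
  shows "\<not> pairwise (\<lambda>u v. R (f u) (f v)) S"
proof
  assume clique: "pairwise (\<lambda>u v. R (f u) (f v)) S"
  then have "inj_on f S" using adj_irrefl by (rule inj_on_if_clique_image)
  then have "finite (f ` S)" "card (f ` S) = n" using assms by (auto simp: card_image)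
  moreover have "pairwise R (f ` S)" using clique by (rule clique_image)
  ultimately show False using clique_free by (auto simp: clique_free_iff)
qed

lemma clique_free_if_homomorphism:
  assumes "\<And>u v. u \<in> V \<Longrightarrow> v \<in> V \<Longrightarrow> E u v \<Longrightarrow> R (f u) (f v)"
  shows "clique_free n V E"
  unfolding clique_free_iff
proof (intro notI, elim exE conjE)
  fix S assume "S \<subseteq> V" "finite S" "card S = n" "pairwise E S"
  then show False using not_clique_image[of S f] assms by (simp add: pairwise_def subset_iff)
qed

lemma n_pos: "0 < n"
  using not_clique_image[of "{}"] by auto

end

locale henson = uncountable_cardinal \<kappa> + clique_free_graph n R
  for n :: nat and \<kappa> :: "'k rel" and R :: "'a \<Rightarrow> 'a \<Rightarrow> bool" +
  assumes true_in_R: "\<sigma> \<in> henson_theory n \<Longrightarrow> true_in R \<sigma>" and saturated: "saturated \<kappa> R"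

lemma henson_if_monster:
  assumes "henson_monster n \<kappa> R"
  shows "henson n \<kappa> R"
proof
  show true: "true_in R \<sigma>" if "\<sigma> \<in> henson_theory n" for \<sigma>
    using assms that by (simp add: henson_monster_def)
  then show "graph R"
    using graph_sentences_in_henson_theory by (auto simp flip: true_in_graph_sentences)
  then show "clique_free n UNIV R"
    using true graph_sentences_in_henson_theory true_in_clique_free_sentence[of R n]
    by (auto simp: graph_def)
qed (use assms in \<open>simp_all add: henson_monster_def\<close>)

context henson
begin

lemma partial_iso_extend_finite:
  assumes P: "partial_iso E R P" "finite P" and E: "graph E" "clique_free n (insert v (Domain P)) E"
  shows "\<exists>y. partial_iso E R (insert (v, y) P)"
proof -
  obtain ps where ps: "set ps = P" using finite_list[OF P(2)] by blast
  then have "set (map fst ps) = Domain P" by (simp add: Domain_fst)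
  then have "true_in R (extension_sentence E (map fst ps) v)"
    using E by (intro true_in_R extension_sentence_in_henson_theory) simp_all
  then show ?thesis
    using P(1) ps unfolding true_in_extension_sentence by (metis length_map zip_map_fst_snd)
qed

lemma partial_iso_extend:
  fixes E :: "'v \<Rightarrow> 'v \<Rightarrow> bool"
  assumes P: "partial_iso E R P" and small: "small \<kappa> (Range P)"
    and E: "graph E" "clique_free n (insert v (Domain P)) E"
  shows "\<exists>y. partial_iso E R (insert (v, y) P)"
proof -
  define \<theta> :: "'v \<times> 'a \<Rightarrow> (unit + 'a) fm" where "\<theta> = (\<lambda>(u, x).
    And (signed (v = u) (Eq (Sym (Inl ())) (Sym (Inr x))))
        (signed (E v u) (Adj (Sym (Inl ())) (Sym (Inr x)))))"
  have models_\<theta>: "models R \<rho> (\<theta> (u, x)) \<longleftrightarrow> (v = u \<longleftrightarrow> \<rho> () = x) \<and> (E v u \<longleftrightarrow> R (\<rho> ()) x)"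
    for \<rho> u x
    by (auto simp: \<theta>_def models_def)
  have "consistent R (\<theta> ` P)"
    unfolding consistent_def
  proof (intro allI impI, elim conjE)
    fix F assume "finite F" "F \<subseteq> \<theta> ` P"
    then obtain Q where Q: "Q \<subseteq> P" "finite Q" "F = \<theta> ` Q" by (metis finite_subset_image)
    have "clique_free n (insert v (Domain Q)) E"
      using E(2) by (rule clique_free_subset) (use Q(1) in auto)
    then obtain y where y: "partial_iso E R (insert (v, y) Q)"
      using partial_iso_extend_finite[OF partial_iso_subset[OF P Q(1)] Q(2) E(1)] by blast
    have "models R (\<lambda>_. y) (\<theta> (u, x))" if "(u, x) \<in> Q" for u x
      using partial_isoD[OF y, of v y u x] that by (simp add: models_\<theta>)
    then show "\<exists>\<rho>. \<forall>\<phi>\<in>F. models R \<rho> \<phi>"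
      unfolding Q(3) by (intro exI[of _ "\<lambda>_. y"]) auto
  qed
  moreover have "\<theta> ` P \<subseteq> lang UNIV (Range P)" by (auto simp: lang_def \<theta>_def)
  ultimately obtain \<rho> where "\<forall>\<phi>\<in>\<theta> ` P. models R \<rho> \<phi>"
    using saturated small unfolding saturated_def by blast
  then have "partial_iso E R (insert (v, \<rho> ()) P)"
    using models_\<theta> by (intro partial_iso_insertI E(1) graph P) blast
  then show ?thesis by blast
qed

lemma embedding_extension:
  fixes E :: "'v \<Rightarrow> 'v \<Rightarrow> bool"
  assumes V: "small \<kappa> V" "V0 \<subseteq> V" and E: "graph E" "clique_free n V E"
    and f0: "embedding E R V0 f0"
  obtains f where "embedding E R V f" "\<And>v. v \<in> V0 \<Longrightarrow> f v = f0 v"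
proof -
  let ?P = "(\<lambda>v. (v, f0 v)) ` V0"
  have "partial_iso E R ?P" "Domain ?P \<subseteq> V" using f0 V(2) by (auto simp: partial_iso_graph_iff)
  then obtain M where M: "partial_iso E R M" "Domain M \<subseteq> V" "?P \<subseteq> M"
    and maximal: "\<And>v y. v \<in> V \<Longrightarrow> partial_iso E R (insert (v, y) M) \<Longrightarrow> (v, y) \<in> M"
    by (rule maximal_partial_iso_exists) blast
  obtain f where f: "M = (\<lambda>v. (v, f v)) ` Domain M" using partial_iso_graphE[OF M(1)] .
  have "Range M = f ` Domain M" by (subst f) auto
  then have small: "small \<kappa> (Range M)" using small_image small_subset V(1) M(2) by metis
  have "v \<in> Domain M" if v: "v \<in> V" for v
  proof -
    have "clique_free n (insert v (Domain M)) E"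
      using E(2) by (rule clique_free_subset) (use v M(2) in blast)
    then obtain y where "partial_iso E R (insert (v, y) M)"
      using partial_iso_extend[OF M(1) small E(1)] by blast
    then show ?thesis using maximal v by blast
  qed
  then have "Domain M = V" using M(2) by blast
  then have "embedding E R V f" using M(1) f partial_iso_graph_iff by metis
  moreover have "f v = f0 v" if "v \<in> V0" for v
  proof -
    have "(v, f0 v) \<in> (\<lambda>v. (v, f v)) ` Domain M" using M(3) that f by auto
    then show ?thesis by auto
  qed
  ultimately show thesis by (rule that)
qed

end

section \<open>Partial isomorphisms preserve formulas\<close>

lemma finite_syms: "finite (syms \<phi>)"
proof (induction \<phi>)
  have "finite (set_tm t)" for t :: "'b tm" by (cases t) auto
  then show "finite (syms (Eq s t))" "finite (syms (Adj s t))" for s t :: "'b tm" by auto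
qed auto

lemma partial_iso_val:
  assumes "wf_tm (length e) s" "wf_tm (length e) t" "length e' = length e"
    and P: "partial_iso R R ((\<lambda>s. (\<rho> s, \<rho>' s)) ` (set_tm s \<union> set_tm t) \<union> set (zip e e'))"
  shows "val \<rho> e s = val \<rho> e t \<longleftrightarrow> val \<rho>' e' s = val \<rho>' e' t"
    and "R (val \<rho> e s) (val \<rho> e t) \<longleftrightarrow> R (val \<rho>' e' s) (val \<rho>' e' t)"
proof -
  have "(val \<rho> e u, val \<rho>' e' u) \<in> (\<lambda>s. (\<rho> s, \<rho>' s)) ` (set_tm s \<union> set_tm t) \<union> set (zip e e')"
    if "u \<in> {s, t}" for u
    using that assms(1-3) by (cases u) (auto simp: set_zip)
  from partial_isoD[OF P this[of s] this[of t]]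
  show "val \<rho> e s = val \<rho> e t \<longleftrightarrow> val \<rho>' e' s = val \<rho>' e' t"
    "R (val \<rho> e s) (val \<rho> e t) \<longleftrightarrow> R (val \<rho>' e' s) (val \<rho>' e' t)" by simp_all
qed

context henson
begin

lemma partial_iso_forth:
  assumes "partial_iso R R P" "finite P"
  shows "\<exists>y. partial_iso R R (insert (x, y) P)"
  using assms graph clique_free_subset[OF clique_free] by (intro partial_iso_extend_finite) auto

lemma partial_iso_back:
  assumes P: "partial_iso R R P" "finite P"
  shows "\<exists>x. partial_iso R R (insert (x, y) P)"
proof -
  have "finite (P\<inverse>)" using P(2) by (simp only: finite_converse)
  then obtain x where "partial_iso R R (insert (y, x) (P\<inverse>))"
    using partial_iso_forth[OF partial_iso_converse[OF P(1)]] by blast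
  from partial_iso_converse[OF this] have "partial_iso R R (insert (x, y) P)"
    by (rule partial_iso_subset) auto
  then show ?thesis by blast
qed

lemma holds_partial_iso:
  assumes "wf_fm (length e) \<phi>" "length e' = length e"
    "partial_iso R R ((\<lambda>s. (\<rho> s, \<rho>' s)) ` syms \<phi> \<union> set (zip e e'))"
  shows "holds R \<rho> e \<phi> \<longleftrightarrow> holds R \<rho>' e' \<phi>"
  using assms
proof (induction \<phi> arbitrary: e e')
  case (Eq s t)
  then show ?case using partial_iso_val(1)[of e s t e' R \<rho> \<rho>'] by simp
next
  case (Adj s t)
  then show ?case using partial_iso_val(2)[of e s t e' R \<rho> \<rho>'] by simp
next
  case (And \<phi> \<psi>)
  have "partial_iso R R ((\<lambda>s. (\<rho> s, \<rho>' s)) ` syms \<phi> \<union> set (zip e e'))"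
    "partial_iso R R ((\<lambda>s. (\<rho> s, \<rho>' s)) ` syms \<psi> \<union> set (zip e e'))"
    by (rule partial_iso_subset[OF And.prems(3)]; auto)+
  then show ?case using And.IH[of e e'] And.prems(1,2) by simp
next
  case (Exi \<phi>)
  let ?P = "(\<lambda>s. (\<rho> s, \<rho>' s)) ` syms \<phi> \<union> set (zip e e')"
  have P: "partial_iso R R ?P" "finite ?P" using Exi.prems(3) finite_syms by auto
  have "holds R \<rho> (a # e) \<phi> \<longleftrightarrow> holds R \<rho>' (a' # e') \<phi>"
    if "partial_iso R R (insert (a, a') ?P)" for a a'
    by (rule Exi.IH) (use Exi.prems that in auto)
  then have "(\<exists>a. holds R \<rho> (a # e) \<phi>) \<longleftrightarrow> (\<exists>a'. holds R \<rho>' (a' # e') \<phi>)"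
    using partial_iso_forth[OF P] partial_iso_back[OF P] by blast
  then show ?case by simp
qed auto

lemma holds_iff_if_partial_iso:
  assumes "wf_fm 0 \<phi>" "partial_iso R R ((\<lambda>s. (\<rho> s, \<rho>' s)) ` syms \<phi>)"
  shows "holds R \<rho> [] \<phi> \<longleftrightarrow> holds R \<rho>' [] \<phi>"
  using holds_partial_iso[of "[]" \<phi> "[]"] assms by simp

end

section \<open>Cliques split between two sets\<close>

text \<open>A clique of size \<open>n\<close>, except that edges inside \<open>X\<close> may be missing.\<close>

definition Kn_pair :: "('a \<Rightarrow> 'a \<Rightarrow> bool) \<Rightarrow> nat \<Rightarrow> 'a set \<Rightarrow> 'a set \<Rightarrow> bool" where
  "Kn_pair R n X T \<longleftrightarrow> finite X \<and> finite T \<and> X \<noteq> {} \<and> T \<noteq> {} \<and> card X + card T = n \<and>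
     pairwise R T \<and> (\<forall>x\<in>X. \<forall>t\<in>T. R x t)"

lemma Kn_if_Kn_pair:
  assumes "Kn_pair R n X T" "X \<subseteq> B" "T \<subseteq> C" "B \<inter> C = {}"
  shows "Kn R n B C"
proof -
  have parts: "(X \<union> T) \<inter> B = X" "(X \<union> T) \<inter> C = T" and "X \<inter> T = {}" using assms(2-4) by blast+
  then have "finite (X \<union> T)" "card (X \<union> T) = n"
    using assms(1) by (simp_all add: Kn_pair_def card_Un_disjoint)
  moreover have "X \<union> T \<subseteq> B \<union> C" using assms(2,3) by blast
  ultimately show ?thesis
    using assms(1) unfolding Kn_def
    by (intro exI[of _ "X \<union> T"]) (simp add: parts Kn_pair_def pairwise_def)
qed

lemma KnE:
  assumes "Kn R n B C" "B \<inter> C = {}"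
  obtains X T where "Kn_pair R n X T" "X \<subseteq> B" "T \<subseteq> C"
proof -
  obtain S where S: "S \<subseteq> B \<union> C" "finite S" "card S = n" "S \<inter> C \<noteq> {}" "S \<inter> B \<noteq> {}"
    "\<forall>u\<in>S \<inter> C. \<forall>v\<in>S \<inter> C. u \<noteq> v \<longrightarrow> R u v" "\<forall>u\<in>S \<inter> B. \<forall>v\<in>S \<inter> C. R u v"
    using assms(1) unfolding Kn_def by (elim exE conjE)
  have "card (S \<inter> B) + card (S \<inter> C) = card ((S \<inter> B) \<union> (S \<inter> C))"
    using S(2) assms(2) by (intro card_Un_disjoint[symmetric]) auto
  also have "(S \<inter> B) \<union> (S \<inter> C) = S" using S(1) by blast
  finally have "Kn_pair R n (S \<inter> B) (S \<inter> C)" using S by (simp add: Kn_pair_def pairwise_def)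
  then show thesis by (rule that) auto
qed

lemma Kn_mono:
  assumes "Kn R n B C" "B \<subseteq> B'" "C \<subseteq> C'" "B' \<inter> C' = {}"
  shows "Kn R n B' C'"
proof -
  have "B \<inter> C = {}" using assms by blast
  then obtain X T where "Kn_pair R n X T" "X \<subseteq> B" "T \<subseteq> C" by (rule KnE[OF assms(1)])
  then show ?thesis using assms(2-4) by (intro Kn_if_Kn_pair[of R n X T]) auto
qed

lemma Kn_pair_not_KnE:
  assumes "Kn R n Y D" "\<not> Kn R n Y C" "Y \<inter> D = {}" "C \<subseteq> D"
  obtains X T where "Kn_pair R n X T" "X \<subseteq> Y" "T \<subseteq> D" "\<not> Kn R n X C"
proof -
  obtain X T where XT: "Kn_pair R n X T" "X \<subseteq> Y" "T \<subseteq> D" by (rule KnE[OF assms(1,3)])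
  moreover have "\<not> Kn R n X C" using Kn_mono[of R n X C Y C] XT(2) assms(2-4) by blast
  ultimately show thesis by (rule that)
qed

lemma card_less_if_Kn_pair: "Kn_pair R n X T \<Longrightarrow> 0 < card X \<and> card X < n"
  by (auto simp: Kn_pair_def card_gt_0_iff)

lemma Kn_pair_homomorphism:
  assumes XT: "Kn_pair R n X T"
    and hom: "\<And>x y. x \<in> X \<union> T \<Longrightarrow> y \<in> X \<union> T \<Longrightarrow> R x y \<Longrightarrow> R' (h x) (h y)"
  shows "pairwise (\<lambda>s t. R' (h s) (h t)) T" "x \<in> X \<Longrightarrow> t \<in> T \<Longrightarrow> R' (h x) (h t)"
proof -
  show "pairwise (\<lambda>s t. R' (h s) (h t)) T"
    using XT by (intro pairwiseI hom) (auto simp: Kn_pair_def pairwise_def)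
  show "R' (h x) (h t)" if "x \<in> X" "t \<in> T" using XT that by (intro hom) (auto simp: Kn_pair_def)
qed

context clique_free_graph
begin

lemma Kn_pair_not_clique_image:
  assumes "Kn_pair R' n X T" and "pairwise (\<lambda>x y. R (r x) (r y)) X"
    and "pairwise (\<lambda>s t. R (\<tau> s) (\<tau> t)) T" and "\<And>x t. x \<in> X \<Longrightarrow> t \<in> T \<Longrightarrow> R (r x) (\<tau> t)"
  shows False
proof -
  have "R (\<tau> t) (r x)" if "x \<in> X" "t \<in> T" for x t using assms(4) that by (blast intro: adj_sym)
  then have "pairwise (\<lambda>u v. R (case_sum r \<tau> u) (case_sum r \<tau> v)) (X <+> T)"
    using assms(2-4) unfolding pairwise_def by (auto split: sum.split)
  moreover have "finite (X <+> T)" "card (X <+> T) = n"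
    using assms(1) by (auto simp: Kn_pair_def card_Plus)
  ultimately show False using not_clique_image by blast
qed

lemma Kn_pair_image:
  assumes XT: "Kn_pair R' n X T" and T: "pairwise (\<lambda>s t. R (\<tau> s) (\<tau> t)) T"
    and join: "\<And>x t. x \<in> X \<Longrightarrow> t \<in> T \<Longrightarrow> R x (\<tau> t)"
  shows "Kn_pair R n X (\<tau> ` T)"
proof -
  have "inj_on \<tau> T" using T adj_irrefl by (rule inj_on_if_clique_image)
  then have "card (\<tau> ` T) = card T" by (rule card_image)
  moreover have "pairwise R (\<tau> ` T)" using T by (rule clique_image)
  ultimately show ?thesis using XT join by (auto simp: Kn_pair_def)
qed

lemma Kn_pair_of_clique:
  assumes S: "finite S" "card S = n" and N: "N \<subseteq> S" "N \<noteq> {}" "N \<noteq> S" "inj_on q N"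
    and adj: "\<And>u v. u \<in> S \<Longrightarrow> v \<in> S - N \<Longrightarrow> u \<noteq> v \<Longrightarrow> R (q u) (q v)"
  shows "Kn_pair R n (q ` N) (q ` (S - N))"
proof -
  have clique: "pairwise (\<lambda>u v. R (q u) (q v)) (S - N)" using adj by (simp add: pairwise_def)
  then have "inj_on q (S - N)" using adj_irrefl by (rule inj_on_if_clique_image)
  then have "card (q ` N) + card (q ` (S - N)) = card N + card (S - N)"
    using N(4) by (simp add: card_image)
  also have "\<dots> = n"
    using card_Diff_subset[OF finite_subset[OF N(1) S(1)] N(1)] card_mono[OF S(1) N(1)] S by simp
  finally have "card (q ` N) + card (q ` (S - N)) = n" .
  moreover have "pairwise R (q ` (S - N))" using clique by (rule clique_image)
  moreover have "R x t" if "x \<in> q ` N" "t \<in> q ` (S - N)" for x t using that adj N(1) by blast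
  ultimately show ?thesis
    using S(1) N finite_subset[OF N(1) S(1)] by (auto simp: Kn_pair_def)
qed

end

section \<open>Indiscernible sequences\<close>

lemma indiscernibleD:
  fixes g h :: "nat \<Rightarrow> nat"
  assumes "indiscernible R C J s" "strict_mono g" "strict_mono h" "\<phi> \<in> lang (UNIV \<times> J) C"
  shows "models R (\<lambda>(i, j). s (g i) j) \<phi> \<longleftrightarrow> models R (\<lambda>(i, j). s (h i) j) \<phi>"
  using assms unfolding indiscernible_def by blast

lemma indiscernible_atoms:
  fixes g h :: "nat \<Rightarrow> nat"
  assumes ind: "indiscernible R C J s" and mono: "strict_mono g" "strict_mono h"
    and uv: "u \<in> J <+> C" "v \<in> J <+> C"
  shows "case_sum (s (g i)) id u = case_sum (s (g k)) id v \<longleftrightarrow>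
      case_sum (s (h i)) id u = case_sum (s (h k)) id v" (is ?eq)
    and "R (case_sum (s (g i)) id u) (case_sum (s (g k)) id v) \<longleftrightarrow>
      R (case_sum (s (h i)) id u) (case_sum (s (h k)) id v)" (is ?adj)
proof -
  have val: "case_sum (\<lambda>(i, j). s (f i) j) id (map_sum (Pair i) id w) = case_sum (s (f i)) id w"
    for f i w by (cases w) auto
  let ?u = "Sym (map_sum (Pair i) id u)" and ?v = "Sym (map_sum (Pair k) id v)"
  have "Eq ?u ?v \<in> lang (UNIV \<times> J) C" "Adj ?u ?v \<in> lang (UNIV \<times> J) C"
    using uv by (auto simp: lang_def)
  from this[THEN indiscernibleD[OF ind mono]] show ?eq ?adj
    by (simp_all only: models_def holds.simps val.simps val)
qed

lemma indiscernible_single: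
  assumes "indiscernible R C J s" "u \<in> J <+> C" "v \<in> J <+> C"
  shows "case_sum (s l) id u = case_sum (s l) id v \<longleftrightarrow> case_sum (s m) id u = case_sum (s m) id v"
    and "R (case_sum (s l) id u) (case_sum (s l) id v) \<longleftrightarrow>
      R (case_sum (s m) id u) (case_sum (s m) id v)"
proof -
  have "strict_mono ((+) l)" "strict_mono ((+) m)" by (auto simp: strict_mono_def)
  from indiscernible_atoms[OF assms(1) this assms(2,3), of 0 0]
  show "case_sum (s l) id u = case_sum (s l) id v \<longleftrightarrow> case_sum (s m) id u = case_sum (s m) id v"
    "R (case_sum (s l) id u) (case_sum (s l) id v) \<longleftrightarrow>
      R (case_sum (s m) id u) (case_sum (s m) id v)"
    by (simp_all only: add_0_right)
qed

lemma indiscernible_pair: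
  assumes "indiscernible R C J s" "u \<in> J <+> C" "v \<in> J <+> C" "l < m" "l' < m'"
  shows "case_sum (s l) id u = case_sum (s m) id v \<longleftrightarrow> case_sum (s l') id u = case_sum (s m') id v"
    and "R (case_sum (s l) id u) (case_sum (s m) id v) \<longleftrightarrow>
      R (case_sum (s l') id u) (case_sum (s m') id v)"
proof -
  have strict_mono_through: "\<exists>g. strict_mono g \<and> g 0 = a \<and> g (1 :: nat) = b"
    if "a < b" for a b :: nat
    by (rule exI[of _ "\<lambda>i. if i = 0 then a else b + i - 1"])
      (use that in \<open>auto simp: strict_mono_def\<close>)
  obtain g :: "nat \<Rightarrow> nat" where g: "strict_mono g" "g 0 = l" "g 1 = m"
    using strict_mono_through[OF assms(4)] by blast
  obtain h :: "nat \<Rightarrow> nat" where h: "strict_mono h" "h 0 = l'" "h 1 = m'"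
    using strict_mono_through[OF assms(5)] by blast
  from indiscernible_atoms[OF assms(1) g(1) h(1) assms(2,3), of 0 1]
  show "case_sum (s l) id u = case_sum (s m) id v \<longleftrightarrow> case_sum (s l') id u = case_sum (s m') id v"
    "R (case_sum (s l) id u) (case_sum (s m) id v) \<longleftrightarrow>
      R (case_sum (s l') id u) (case_sum (s m') id v)"
    by (simp_all only: g h)
qed

lemma indiscernible_eq_first:
  assumes ind: "indiscernible R C J s" and uv: "u \<in> J <+> C" "v \<in> J <+> C"
    and eq: "case_sum (s l) id u = case_sum (s m) id v"
  shows "case_sum (s 0) id u = case_sum (s 0) id v"
proof -
  have eq_if_less: "case_sum (s 0) id u = case_sum (s 0) id v"
    if eq: "case_sum (s l) id u = case_sum (s m) id v" and "l < m" "u \<in> J <+> C" "v \<in> J <+> C"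
    for l m u v
  proof -
    have "case_sum (s 0) id u = case_sum (s 1) id v" "case_sum (s 0) id u = case_sum (s 2) id v"
      using eq indiscernible_pair(1)[OF ind that(3,4,2)] by simp_all
    moreover from this have "case_sum (s 0) id v = case_sum (s 1) id v"
      using indiscernible_pair(1)[OF ind that(4,4), of 1 2 0 1] by simp
    ultimately show ?thesis by simp
  qed
  show ?thesis
  proof (cases l m rule: linorder_cases)
    case less
    then show ?thesis using eq_if_less[OF eq _ uv] by blast
  next
    case equal
    then show ?thesis using eq indiscernible_single(1)[OF ind uv] by blast
  next
    case greater
    then show ?thesis using eq_if_less[OF eq[symmetric] _ uv(2,1)] by simp
  qed
qed

lemma (in clique_free_graph) indiscernible_not_adj:
  assumes ind: "indiscernible R C J s" and u: "u \<in> J <+> C"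
  shows "\<not> R (case_sum (s l) id u) (case_sum (s m) id u)"
proof -
  have not_adj_if_less: "\<not> R (case_sum (s l) id u) (case_sum (s m) id u)" if "l < m" for l m
  proof
    assume "R (case_sum (s l) id u) (case_sum (s m) id u)"
    then have adj_if_less: "R (case_sum (s i) id u) (case_sum (s k) id u)" if "i < k" for i k
      using indiscernible_pair(2)[OF ind u u \<open>l < m\<close> that] by blast
    have "R (case_sum (s i) id u) (case_sum (s k) id u)" if "i \<noteq> k" for i k
      using that adj_if_less adj_sym by (cases i k rule: linorder_cases) auto
    then have "pairwise (\<lambda>i k. R (case_sum (s i) id u) (case_sum (s k) id u)) {..<n}"
      by (simp add: pairwise_def)
    then show False using not_clique_image[of "{..<n}"] by simp
  qed
  then show ?thesis using adj_sym adj_irrefl by (cases l m rule: linorder_cases) auto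
qed

definition copies :: "('a \<Rightarrow> 'a \<Rightarrow> bool) \<Rightarrow> 'a set \<Rightarrow> 'a set \<Rightarrow> (nat \<Rightarrow> 'a \<Rightarrow> 'a) \<Rightarrow> bool" where
  "copies R C D s \<longleftrightarrow>
     (\<forall>l. embedding R R D (s l) \<and> (\<forall>c\<in>C. s l c = c)) \<and>
     (\<forall>l m. \<forall>x\<in>D. \<forall>y\<in>D. s l x = s m y \<longrightarrow> x = y) \<and>
     (\<forall>l m. \<forall>x\<in>D. \<not> R (s l x) (s m x))"

lemma copiesD:
  assumes "copies R C D s"
  shows "embedding R R D (s l)" "c \<in> C \<Longrightarrow> s l c = c"
    "x \<in> D \<Longrightarrow> y \<in> D \<Longrightarrow> s l x = s m y \<Longrightarrow> x = y" "x \<in> D \<Longrightarrow> \<not> R (s l x) (s m x)"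
  using assms unfolding copies_def by blast+

lemma (in clique_free_graph) copies_of_indiscernible:
  assumes ind: "indiscernible R C J s"
  obtains t where "copies R C (s 0 ` J \<union> C) t" "\<And>l j. j \<in> J \<Longrightarrow> t l (s 0 j) = s l j"
proof
  let ?val = "\<lambda>l. case_sum (s l) id"
  define t where "t l x = ?val l (inv_into (J <+> C) (?val 0) x)" for l x
  have t: "t l (?val 0 u) = ?val l u" if u: "u \<in> J <+> C" for l u
  proof -
    let ?u = "inv_into (J <+> C) (?val 0) (?val 0 u)"
    have "?u \<in> J <+> C" "?val 0 ?u = ?val 0 u" using u by (auto intro!: inv_into_into f_inv_into_f)
    from iffD1[OF indiscernible_single(1)[OF ind this(1) u] this(2)] show ?thesis
      unfolding t_def .
  qed
  show "t l (s 0 j) = s l j" if "j \<in> J" for l j using t[OF InlI[OF that]] by simp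
  have D: "s 0 ` J \<union> C = ?val 0 ` (J <+> C)" by (force simp: image_iff)
  show "copies R C (s 0 ` J \<union> C) t"
    unfolding copies_def D embedding_def inj_on_def
  proof (intro conjI allI ballI impI; (elim imageE)?)
    fix l c assume "c \<in> C"
    then show "t l c = c" using t[OF InrI, of c] by simp
  next
    fix l m x y u v
    assume "x = ?val 0 u" "u \<in> J <+> C" "y = ?val 0 v" "v \<in> J <+> C"
    then show "t l x = t l y \<Longrightarrow> x = y" "t l x = t m y \<Longrightarrow> x = y" "R x y \<longleftrightarrow> R (t l x) (t l y)"
      using indiscernible_eq_first[OF ind, of u v] indiscernible_single(2)[OF ind, of u v] t by auto
  next
    fix l m x u assume "x = ?val 0 u" "u \<in> J <+> C"
    then show "\<not> R (t l x) (t m x)" using indiscernible_not_adj[OF ind] t by simp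
  qed
qed

definition copy_source :: "'a set \<Rightarrow> (nat \<Rightarrow> 'a \<Rightarrow> 'a) \<Rightarrow> 'a \<Rightarrow> 'a" where
  "copy_source D s d = (SOME x. x \<in> D \<and> (\<exists>l. d = s l x))"

lemma copy_source_eq:
  assumes s: "copies R C D s" and x: "x \<in> D"
  shows "copy_source D s (s l x) = x"
  unfolding copy_source_def using x copiesD(3)[OF s] by (intro some_equality) auto

lemma copy_source_in:
  assumes s: "copies R C D s" and d: "d \<in> (\<Union>l. s l ` B)" and BD: "B \<subseteq> D"
  shows "copy_source D s d \<in> B" "\<exists>l. d = s l (copy_source D s d)"
proof -
  obtain l x where "d = s l x" "x \<in> B" using d by blast
  moreover from this have "copy_source D s d = x" using copy_source_eq[OF s] BD by blast
  ultimately show "copy_source D s d \<in> B" "\<exists>l. d = s l (copy_source D s d)" by auto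
qed

lemma inj_on_copy_source:
  assumes s: "copies R C D s" and M: "M \<subseteq> (\<Union>l. s l ` D)" "pairwise R M"
  shows "inj_on (copy_source D s) M"
proof (rule inj_onI, rule ccontr)
  let ?p = "copy_source D s"
  fix d d' assume d: "d \<in> M" "d' \<in> M" and eq: "?p d = ?p d'" and "d \<noteq> d'"
  then have "R d d'" using M(2) by (simp add: pairwise_def)
  moreover obtain l m where "d = s l (?p d)" "d' = s m (?p d)" "?p d \<in> D"
    using copy_source_in[OF s _ subset_refl] d M(1) eq by (metis subsetD)
  ultimately show False using copiesD(4)[OF s] by metis
qed

lemma copy_source_fixed:
  assumes "copies R C D s" "c \<in> C" "c \<in> D"
  shows "copy_source D s c = c"
  using copy_source_eq[OF assms(1,3)] copiesD(2)[OF assms(1,2)] by metis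

text \<open>
  The points of \<open>A\<close>, on the right, are joined to every copy \<open>s l x\<close>, on the left, as they are
  to \<open>x\<close>.
\<close>

definition amalgam :: "('a \<Rightarrow> 'a \<Rightarrow> bool) \<Rightarrow> ('a \<Rightarrow> 'a) \<Rightarrow> 'a + 'a \<Rightarrow> 'a + 'a \<Rightarrow> bool" where
  "amalgam R p u v \<longleftrightarrow> (if isl u \<and> isl v then R (projl u) (projl v)
     else R (case_sum p id u) (case_sum p id v))"

context clique_free_graph
begin

lemma copies_clique_not_Kn:
  assumes s: "copies R C D s" and CD: "C \<subseteq> D"
    and M: "M \<subseteq> (\<Union>l. s l ` (D - C))" "pairwise R M"
  shows "\<not> Kn R n (copy_source D s ` M) C"
proof
  let ?p = "copy_source D s"
  have source: "?p d \<in> D - C" "\<exists>l. d = s l (?p d)" if "d \<in> M" for d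
    using copy_source_in[OF s _ Diff_subset] subsetD[OF M(1) that] by auto
  then have "(?p ` M) \<inter> C = {}" by blast
  moreover assume "Kn R n (?p ` M) C"
  ultimately obtain X T where XT: "Kn_pair R n X T" "X \<subseteq> ?p ` M" "T \<subseteq> C" using KnE by blast
  define r where "r = inv_into M ?p"
  have r: "r x \<in> M" "?p (r x) = x" if "x \<in> X" for x
    using that XT(2) by (auto simp: r_def intro: inv_into_into f_inv_into_f)
  have "R (r x) t" if xt: "x \<in> X" "t \<in> T" for x t
  proof -
    obtain l where l: "r x = s l x" using source(2)[OF r(1)] r(2) xt(1) by metis
    have "x \<in> D" "t \<in> C" "R x t" using xt XT source(1) by (auto simp: Kn_pair_def)
    then have "R (s l x) (s l t)" using CD embedding_adj_iff[OF copiesD(1)[OF s]] by blast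
    then show ?thesis using l copiesD(2)[OF s \<open>t \<in> C\<close>] by simp
  qed
  moreover have "pairwise (\<lambda>x y. R (r x) (r y)) X"
    using r by (intro pairwiseI pairwiseD[OF M(2)]) metis+
  moreover have "pairwise (\<lambda>s t. R (id s) (id t)) T" using XT(1) by (simp add: Kn_pair_def)
  ultimately show False using Kn_pair_not_clique_image[OF XT(1), of r id] by simp
qed

lemma amalgam_copies_adj:
  assumes s: "copies R C D s" and CD: "C \<subseteq> D"
    and uv: "u \<in> Inl ` C \<union> range Inr" "v \<in> Inl ` (\<Union>l. s l ` D) \<union> range Inr"
    and adj: "amalgam R (copy_source D s) u v"
  shows "R (case_sum (copy_source D s) id u) (case_sum (copy_source D s) id v)"
proof (cases "isl u \<and> isl v")
  case False
  then show ?thesis using adj by (auto simp: amalgam_def)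
next
  case True
  then obtain c l x where c: "u = Inl c" "c \<in> C" and x: "v = Inl (s l x)" "x \<in> D" using uv by auto
  then have "R (s l c) (s l x)" using adj copiesD(2)[OF s] by (simp add: amalgam_def)
  then have "R c x" using embedding_adj_iff[OF copiesD(1)[OF s]] c x CD by blast
  then show ?thesis using c x CD copy_source_eq[OF s] copy_source_fixed[OF s] by auto
qed

lemma amalgam_copies_cliqueE:
  assumes s: "copies R C D s" and CD: "C \<subseteq> D"
    and S: "S \<subseteq> Inl ` (\<Union>l. s l ` D) \<union> Inr ` A" "finite S" "card S = n"
    and clique: "pairwise (amalgam R (copy_source D s)) S"
  obtains M T where "M \<subseteq> (\<Union>l. s l ` (D - C))" "pairwise R M" "T \<subseteq> A \<union> C"
    "Kn_pair R n (copy_source D s ` M) T"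
proof -
  let ?p = "copy_source D s"
  let ?q = "case_sum ?p id"
  define M where "M = {d. Inl d \<in> S \<and> d \<notin> C}"
  have rest: "S - Inl ` M \<subseteq> Inl ` C \<union> Inr ` A"
  proof
    fix u assume "u \<in> S - Inl ` M"
    then show "u \<in> Inl ` C \<union> Inr ` A" using S(1) by (cases u) (auto simp: M_def)
  qed
  have M: "M \<subseteq> (\<Union>l. s l ` (D - C))" using S(1) copiesD(2)[OF s] by (fastforce simp: M_def)
  have clique_M: "pairwise R M"
  proof (rule pairwiseI)
    fix d d' assume "d \<in> M" "d' \<in> M" "d \<noteq> d'"
    then show "R d d'"
      using pairwiseD[OF clique, of "Inl d" "Inl d'"] by (auto simp: M_def amalgam_def)
  qed
  have adj: "R (?q u) (?q v)" if "u \<in> S" "v \<in> S - Inl ` M" "u \<noteq> v" for u v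
  proof (rule adj_sym, rule amalgam_copies_adj[OF s CD])
    show "v \<in> Inl ` C \<union> range Inr" using subsetD[OF rest that(2)] by auto
    show "u \<in> Inl ` (\<Union>l. s l ` D) \<union> range Inr" using subsetD[OF S(1) that(1)] by auto
    show "amalgam R ?p v u" using pairwiseD[OF clique, of v u] that by simp
  qed
  have "pairwise (\<lambda>u v. R (projl u) (projl v)) (Inl ` M)"
    using clique_M by (auto simp: pairwise_def)
  then have "Inl ` M \<noteq> S" using not_clique_image[OF S(2,3)] by blast
  moreover have "Inl ` M \<noteq> {}"
    using not_clique_image[OF S(2,3), of ?q] adj by (auto simp: pairwise_def)
  moreover have "inj_on ?p M" using M by (intro inj_on_copy_source[OF s _ clique_M]) blast
  then have "inj_on ?q (Inl ` M)" by (simp add: inj_on_def)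
  ultimately have "Kn_pair R n (?q ` Inl ` M) (?q ` (S - Inl ` M))"
    using S(2,3) adj by (intro Kn_pair_of_clique) (auto simp: M_def)
  then have "Kn_pair R n (?p ` M) (?q ` (S - Inl ` M))" by (simp add: image_image)
  moreover have "?q u \<in> A \<union> C" if "u \<in> S - Inl ` M" for u
    using subsetD[OF rest that] copy_source_fixed[OF s] CD by auto
  ultimately show thesis using M clique_M by (intro that) auto
qed

lemma amalgam_copies_clique_free:
  assumes s: "copies R C D s" and CD: "C \<subseteq> D" and AD: "A \<inter> D = {}"
    and Kn: "\<And>X. finite X \<Longrightarrow> X \<subseteq> D - C \<Longrightarrow> Kn R n X (A \<union> C) \<Longrightarrow> Kn R n X C"
  shows "clique_free n (Inl ` (\<Union>l. s l ` D) \<union> Inr ` A) (amalgam R (copy_source D s))"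
  unfolding clique_free_iff
proof (intro notI, elim exE conjE)
  let ?p = "copy_source D s"
  fix S
  assume "S \<subseteq> Inl ` (\<Union>l. s l ` D) \<union> Inr ` A" "finite S" "card S = n"
    "pairwise (amalgam R ?p) S"
  then obtain M T where M: "M \<subseteq> (\<Union>l. s l ` (D - C))" "pairwise R M" and T: "T \<subseteq> A \<union> C"
    and pair: "Kn_pair R n (?p ` M) T"
    by (rule amalgam_copies_cliqueE[OF s CD])
  have p_M: "?p ` M \<subseteq> D - C"
    using copy_source_in(1)[OF s subsetD[OF M(1)] Diff_subset] by (rule image_subsetI)
  have "Kn R n (?p ` M) (A \<union> C)"
    using pair subset_refl T by (rule Kn_if_Kn_pair) (use p_M AD in blast)
  moreover have "finite (?p ` M)" using pair by (simp add: Kn_pair_def)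
  ultimately have "Kn R n (?p ` M) C" using p_M by (intro Kn)
  then show False using copies_clique_not_Kn[OF s CD M] by blast
qed

end

context henson
begin

lemma copies_realization:
  assumes s: "copies R C D s" and CD: "C \<subseteq> D" and AD: "A \<inter> D = {}"
    and small: "small \<kappa> A" "small \<kappa> D"
    and Kn: "\<And>X. finite X \<Longrightarrow> X \<subseteq> D - C \<Longrightarrow> Kn R n X (A \<union> C) \<Longrightarrow> Kn R n X C"
  obtains \<rho> where "\<And>l. embedding R R (A \<union> D) (\<lambda>u. if u \<in> A then \<rho> u else s l u)"
proof -
  let ?E = "amalgam R (copy_source D s)" and ?D = "\<Union>l. s l ` D"
  let ?V = "Inl ` ?D \<union> Inr ` A"
  have "small \<kappa> ?V" by (intro small_Un small_image small_UN_nat small)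
  moreover have "graph ?E" using adj_sym adj_irrefl by (auto simp: graph_def amalgam_def)
  moreover have "clique_free n ?V ?E" using amalgam_copies_clique_free[OF s CD AD Kn] .
  moreover have "embedding ?E R (Inl ` ?D) projl"
    by (auto simp: embedding_def inj_on_def amalgam_def)
  ultimately obtain f where f: "embedding ?E R ?V f"
    and f_Inl: "\<And>v. v \<in> Inl ` ?D \<Longrightarrow> f v = projl v"
    using embedding_extension[of ?V "Inl ` ?D"] by blast
  have "embedding R R (A \<union> D) (\<lambda>u. if u \<in> A then f (Inr u) else s l u)" for l
  proof -
    define w where "w u = (if u \<in> A then Inr u else Inl (s l u))" for u
    have "embedding R ?E (A \<union> D) w"
      using embeddingD[OF copiesD(1)[OF s, of l]] copy_source_eq[OF s]
      by (auto simp: embedding_def inj_on_def w_def amalgam_def)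
    moreover have "embedding ?E R (w ` (A \<union> D)) f"
      using f by (rule embedding_subset) (auto simp: w_def)
    ultimately have "embedding R R (A \<union> D) (f \<circ> w)" by (rule embedding_comp)
    moreover have "(f \<circ> w) u = (if u \<in> A then f (Inr u) else s l u)" if "u \<in> A \<union> D" for u
      using that f_Inl[of "Inl (s l u)"] by (auto simp: w_def)
    ultimately show ?thesis by (simp add: embedding_def inj_on_def)
  qed
  then show thesis by (rule that)
qed

end

section \<open>Crossed copies\<close>

text \<open>
  A clique that meets two copies outside \<open>C\<close> meets them in distinct points of \<open>X\<close> only, so that it
  projects to a witness of \<open>Kn R n X C\<close>.
\<close>

definition crossed_graph ::
  "('a \<Rightarrow> 'a \<Rightarrow> bool) \<Rightarrow> 'a set \<Rightarrow> 'a set \<Rightarrow> nat \<times> 'a \<Rightarrow> nat \<times> 'a \<Rightarrow> bool" where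
  "crossed_graph R X C u v \<longleftrightarrow>
     (if fst u = fst v \<or> snd u \<in> C \<or> snd v \<in> C then R (snd u) (snd v)
      else snd u \<in> X \<and> snd v \<in> X \<and> snd u \<noteq> snd v)"

lemma (in clique_free_graph) crossed_clique_meets_copies:
  assumes S: "finite S" "card S = n" and clique: "pairwise (crossed_graph R X C) S"
  shows "\<exists>u\<in>S. snd u \<notin> C" "u \<in> S \<Longrightarrow> snd u \<notin> C \<Longrightarrow> snd u \<in> X"
proof -
  have "\<not> pairwise (\<lambda>u v. R (snd u) (snd v)) S" using not_clique_image[OF S(1,2)] .
  then obtain u0 v0 where uv0: "u0 \<in> S" "v0 \<in> S" "u0 \<noteq> v0" "\<not> R (snd u0) (snd v0)"
    unfolding pairwise_def by blast
  then have levels: "fst u0 \<noteq> fst v0" and outside: "snd u0 \<notin> C" "snd v0 \<notin> C"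
    using pairwiseD[OF clique uv0(1-3)] by (auto simp: crossed_graph_def split: if_splits)
  then show "\<exists>u\<in>S. snd u \<notin> C" using uv0(1) by blast
  show "snd u \<in> X" if "u \<in> S" "snd u \<notin> C"
    using pairwiseD[OF clique, of u u0] pairwiseD[OF clique, of u v0] uv0 levels outside that
    by (cases "fst u = fst u0") (force simp: crossed_graph_def)+
qed

lemma (in clique_free_graph) crossed_graph_clique_free:
  assumes X: "finite X" "card X < n" "X \<inter> C = {}" "\<not> Kn R n X C"
  shows "clique_free n UNIV (crossed_graph R X C)"
  unfolding clique_free_iff
proof (intro notI, elim exE conjE)
  fix S assume S: "finite S" "card S = n" and clique: "pairwise (crossed_graph R X C) S"
  define N where "N = {u \<in> S. snd u \<notin> C}"
  have N_X: "snd u \<in> X" if "u \<in> N" for u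
    using crossed_clique_meets_copies(2)[OF S clique] that by (simp add: N_def)
  have adj: "R (snd u) (snd v)" if "u \<in> S" "v \<in> S - N" "u \<noteq> v" for u v
    using pairwiseD[OF clique, of u v] that by (auto simp: crossed_graph_def N_def)
  have inj: "inj_on snd N"
  proof (rule inj_onI, rule ccontr)
    fix u v assume "u \<in> N" "v \<in> N" "snd u = snd v" "u \<noteq> v"
    then show False
      using pairwiseD[OF clique, of u v] adj_irrefl
      by (auto simp: crossed_graph_def N_def split: if_splits)
  qed
  have "N \<noteq> S"
  proof
    assume "N = S"
    then have "n = card (snd ` N)" using inj S(2) by (simp add: card_image)
    also have "\<dots> \<le> card X" using N_X by (intro card_mono X(1)) blast
    finally have "n \<le> card X" .
    then show False using X(2) by simp
  qed
  moreover have "N \<subseteq> S" "N \<noteq> {}"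
    using crossed_clique_meets_copies(1)[OF S clique] unfolding N_def by blast+
  ultimately have "Kn_pair R n (snd ` N) (snd ` (S - N))"
    using S inj adj by (intro Kn_pair_of_clique) blast+
  then have "Kn R n X C" by (rule Kn_if_Kn_pair) (use N_X X(3) in \<open>auto simp: N_def\<close>)
  then show False using X(4) by blast
qed

definition crossed_copies ::
  "('a \<Rightarrow> 'a \<Rightarrow> bool) \<Rightarrow> 'a set \<Rightarrow> 'a set \<Rightarrow> 'a set \<Rightarrow> (nat \<Rightarrow> 'a \<Rightarrow> 'a) \<Rightarrow> bool" where
  "crossed_copies R X C D s \<longleftrightarrow>
     (\<forall>x\<in>D. s 0 x = x) \<and>
     (\<forall>l m. \<forall>x\<in>D. \<forall>y\<in>D. (s l x = s m y \<longleftrightarrow> x = y \<and> (l = m \<or> x \<in> C)) \<and>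
        (R (s l x) (s m y) \<longleftrightarrow> crossed_graph R X C (l, x) (m, y)))"

lemma crossed_copiesD:
  assumes "crossed_copies R X C D s" "x \<in> D"
  shows "s 0 x = x"
    and "y \<in> D \<Longrightarrow> s l x = s m y \<longleftrightarrow> x = y \<and> (l = m \<or> x \<in> C)"
    and "y \<in> D \<Longrightarrow> R (s l x) (s m y) \<longleftrightarrow> crossed_graph R X C (l, x) (m, y)"
    and "x \<in> C \<Longrightarrow> s l x = x"
  using assms unfolding crossed_copies_def by metis+

lemma (in henson) crossed_copies_exist:
  assumes D: "small \<kappa> D" "C \<subseteq> D" and X: "finite X" "card X < n" "X \<inter> C = {}" "\<not> Kn R n X C"
  shows "\<exists>s. crossed_copies R X C D s"
proof -
  let ?E = "crossed_graph R X C"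
  define V where "V = {u. snd u \<in> D \<and> (snd u \<in> C \<longrightarrow> fst u = (0 :: nat))}"
  have "small \<kappa> V" using small_nat_Times[OF D(1)] by (rule small_subset) (auto simp: V_def)
  moreover have "{0} \<times> D \<subseteq> V" by (auto simp: V_def)
  moreover have "graph ?E" using adj_sym adj_irrefl by (auto simp: graph_def crossed_graph_def)
  moreover have "clique_free n V ?E"
    using crossed_graph_clique_free[OF X] by (rule clique_free_subset) simp
  moreover have "embedding ?E R ({0} \<times> D) snd"
    by (auto simp: embedding_def inj_on_def crossed_graph_def)
  ultimately obtain f where f: "embedding ?E R V f" and f0: "\<And>v. v \<in> {0} \<times> D \<Longrightarrow> f v = snd v"
    using embedding_extension[of V "{0} \<times> D" ?E snd] by blast
  define s where "s l x = f (if x \<in> C then 0 else l, x)" for l x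
  have "crossed_copies R X C D s"
    unfolding crossed_copies_def
  proof (intro conjI ballI allI)
    show "s 0 x = x" if "x \<in> D" for x using f0[of "(0, x)"] that by (simp add: s_def)
    fix l m x y assume "x \<in> D" "y \<in> D"
    then have "(if x \<in> C then 0 else l, x) \<in> V" "(if y \<in> C then 0 else m, y) \<in> V"
      by (auto simp: V_def)
    from embeddingD[OF f this]
    show "s l x = s m y \<longleftrightarrow> x = y \<and> (l = m \<or> x \<in> C)" "R (s l x) (s m y) \<longleftrightarrow> ?E (l, x) (m, y)"
      by (auto simp: s_def crossed_graph_def)
  qed
  then show ?thesis by blast
qed

lemma (in henson) crossed_copies_indiscernible:
  fixes b :: "'j \<Rightarrow> 'a"
  assumes s: "crossed_copies R X C D s" and D: "b ` J \<subseteq> D" "C \<subseteq> D"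
  shows "indiscernible R C J (\<lambda>l j. s l (b j))"
  unfolding indiscernible_def models_def
proof (intro ballI allI impI, elim conjE)
  fix \<phi> :: "((nat \<times> 'j) + 'a) fm" and g h :: "nat \<Rightarrow> nat"
  assume \<phi>: "\<phi> \<in> lang (UNIV \<times> J) C" and mono: "strict_mono g" "strict_mono h"
  let ?val = "\<lambda>f :: nat \<Rightarrow> nat. case_sum (\<lambda>(i, j). s (f i) (b j)) id"
  define k :: "nat \<times> 'j + 'a \<Rightarrow> nat" where "k = case_sum fst (\<lambda>_. 0)"
  define z :: "nat \<times> 'j + 'a \<Rightarrow> 'a" where "z = case_sum (\<lambda>(i, j). b j) id"
  have val: "?val f u = s (f (k u)) (z u) \<and> z u \<in> D" if "u \<in> syms \<phi>" for f u
  proof -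
    have "u \<in> UNIV \<times> J <+> C" using that \<phi> by (auto simp: lang_def)
    then show ?thesis using D crossed_copiesD(4)[OF s] by (auto simp: k_def z_def)
  qed
  have "partial_iso R R ((\<lambda>u. (?val g u, ?val h u)) ` syms \<phi>)"
    using val mono unfolding partial_iso_image_iff
    by (simp add: crossed_copiesD(2,3)[OF s] crossed_graph_def strict_mono_eq)
  then show "holds R (?val g) [] \<phi> \<longleftrightarrow> holds R (?val h) [] \<phi>"
    using \<phi> by (intro holds_iff_if_partial_iso) (simp_all add: lang_def)
qed

lemma crossed_copies_embedding:
  assumes "crossed_copies R X C D s"
  shows "embedding R R D (s l)"
  using crossed_copiesD(2,3)[OF assms] by (auto simp: embedding_def inj_on_def crossed_graph_def)

lemma crossed_copies_transversal:
  assumes s: "crossed_copies R X C D s" and X: "X \<subseteq> D - C" and e: "inj_on e X"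
  shows "pairwise (\<lambda>x y. R (s (e x) x) (s (e y) y)) X"
proof (rule pairwiseI)
  fix x y assume xy: "x \<in> X" "y \<in> X" "x \<noteq> y"
  then have "e x \<noteq> e y" using e by (simp add: inj_on_eq_iff)
  moreover have "x \<in> D - C" "y \<in> D - C" using xy X by auto
  ultimately show "R (s (e x) x) (s (e y) y)"
    using xy crossed_copiesD(3)[OF s, of x y "e x" "e y"] by (simp add: crossed_graph_def)
qed

section \<open>Criteria for dividing\<close>

abbreviation assign :: "('i \<Rightarrow> 'a) \<Rightarrow> ('j \<Rightarrow> 'a) \<Rightarrow> ('i + 'j) + 'a \<Rightarrow> 'a" where
  "assign a b \<equiv> case_sum (case_sum a b) id"

lemma holds_map_fm: "holds R \<rho> e (map_fm f \<phi>) \<longleftrightarrow> holds R (\<rho> \<circ> f) e \<phi>"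
proof (induction \<phi> arbitrary: e)
  have "val \<rho> e (map_tm f t) = val (\<rho> \<circ> f) e t" for e t by (cases t) auto
  then show "holds R \<rho> e (map_fm f (Eq s t)) \<longleftrightarrow> holds R (\<rho> \<circ> f) e (Eq s t)"
    "holds R \<rho> e (map_fm f (Adj s t)) \<longleftrightarrow> holds R (\<rho> \<circ> f) e (Adj s t)" for e s t by simp_all
qed auto

lemma models_inst: "models R a (inst b \<phi>) \<longleftrightarrow> holds R (assign a b) [] \<phi>"
proof -
  have "case_sum a id \<circ> case_sum (case_sum Inl (\<lambda>j. Inr (b j))) Inr = assign a b"
    by (rule ext) (auto split: sum.splits)
  then show ?thesis by (simp add: models_def inst_def holds_map_fm)
qed

lemma (in henson) models_inst_embedding:
  assumes \<phi>: "\<phi> \<in> lang (I <+> J) C"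
    and f: "embedding R R V f" "a ` I \<union> b ` J \<union> C \<subseteq> V" "\<And>c. c \<in> C \<Longrightarrow> f c = c"
    and image: "\<And>i. i \<in> I \<Longrightarrow> a' i = f (a i)" "\<And>j. j \<in> J \<Longrightarrow> b' j = f (b j)"
  shows "models R a (inst b \<phi>) \<longleftrightarrow> models R a' (inst b' \<phi>)"
proof -
  have "assign a b u \<in> V \<and> assign a' b' u = f (assign a b u)" if "u \<in> syms \<phi>" for u
  proof -
    have "u \<in> (I <+> J) <+> C" using that \<phi> by (auto simp: lang_def)
    then show ?thesis using f(2,3) image by auto
  qed
  then have "partial_iso R R ((\<lambda>u. (assign a b u, assign a' b' u)) ` syms \<phi>)"
    by (simp add: partial_iso_image_iff embeddingD[OF f(1)])
  then show ?thesis
    using \<phi> by (simp add: models_inst lang_def holds_iff_if_partial_iso)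
qed

lemma (in henson) not_divides_if_Kn:
  assumes small: "small \<kappa> (a ` I)" "small \<kappa> (b ` J)" "small \<kappa> C"
    and disj: "a ` I \<inter> b ` J \<subseteq> C"
    and \<pi>: "\<pi> \<subseteq> lang (I <+> J) C" "\<And>\<phi>. \<phi> \<in> \<pi> \<Longrightarrow> models R a (inst b \<phi>)"
    and Kn: "\<And>X. finite X \<Longrightarrow> X \<subseteq> b ` J - C \<Longrightarrow> Kn R n X (a ` I \<union> C) \<Longrightarrow> Kn R n X C"
  shows "\<not> divides R C J \<pi> b"
proof
  assume "divides R C J \<pi> b"
  then obtain s where s: "indiscernible R C J s" "\<And>j. j \<in> J \<Longrightarrow> s 0 j = b j"
    and inconsistent: "\<not> consistent R (\<Union>l. inst (s l) ` \<pi>)"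
    unfolding divides_def by blast
  let ?A = "a ` I - C" and ?D = "b ` J \<union> C"
  obtain t where t: "copies R C (s 0 ` J \<union> C) t" "\<And>l j. j \<in> J \<Longrightarrow> t l (s 0 j) = s l j"
    by (rule copies_of_indiscernible[OF s(1)]) blast
  have "s 0 ` J \<union> C = ?D" using s(2) by auto
  then have copies: "copies R C ?D t" using t(1) by simp
  obtain \<rho> where \<rho>: "\<And>l. embedding R R (?A \<union> ?D) (\<lambda>u. if u \<in> ?A then \<rho> u else t l u)"
  proof (rule copies_realization[OF copies])
    show "?A \<inter> ?D = {}" using disj by blast
    show "small \<kappa> ?A" "small \<kappa> ?D" using small small_subset[OF small(1)] small_Un by auto
    show "Kn R n X C" if "finite X" "X \<subseteq> ?D - C" "Kn R n X (?A \<union> C)" for X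
      using that by (intro Kn) auto
  qed auto
  have "models R (\<lambda>i. if a i \<in> ?A then \<rho> (a i) else a i) (inst (s l) \<phi>)" if \<phi>: "\<phi> \<in> \<pi>" for l \<phi>
  proof (rule iffD1[OF models_inst_embedding[OF _ \<rho>[of l]]])
    show "\<phi> \<in> lang (I <+> J) C" "models R a (inst b \<phi>)" using \<pi> \<phi> by auto
    show "a ` I \<union> b ` J \<union> C \<subseteq> ?A \<union> ?D" by blast
    show "(if c \<in> ?A then \<rho> c else t l c) = c" if "c \<in> C" for c
      using that copiesD(2)[OF copies] by simp
    show "(if a i \<in> ?A then \<rho> (a i) else a i) = (if a i \<in> ?A then \<rho> (a i) else t l (a i))"
      if "i \<in> I" for i using that copiesD(2)[OF copies] by auto
    show "s l j = (if b j \<in> ?A then \<rho> (b j) else t l (b j))" if "j \<in> J" for j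
      using that disj s(2) t(2) by auto
  qed
  then show False using inconsistent unfolding consistent_def by blast
qed

lemma (in henson) divides_if_crossed_copies:
  fixes N :: nat
  assumes s: "crossed_copies R X C (b ` J \<union> C) s" and F: "finite F" "F \<subseteq> \<pi>"
    and inconsistent: "\<And>\<rho>. (\<And>l \<phi>. l < N \<Longrightarrow> \<phi> \<in> F \<Longrightarrow> models R \<rho> (inst (\<lambda>j. s l (b j)) \<phi>)) \<Longrightarrow> False"
  shows "divides R C J \<pi> b"
proof -
  have "indiscernible R C J (\<lambda>l j. s l (b j))" by (rule crossed_copies_indiscernible[OF s]) auto
  moreover have "\<forall>j\<in>J. s 0 (b j) = b j" using crossed_copiesD(1)[OF s] by simp
  moreover have "\<not> consistent R (\<Union>l. inst (\<lambda>j. s l (b j)) ` \<pi>)"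
  proof
    let ?F = "\<Union>l<N. inst (\<lambda>j. s l (b j)) ` F"
    assume "consistent R (\<Union>l. inst (\<lambda>j. s l (b j)) ` \<pi>)"
    moreover have "finite ?F" "?F \<subseteq> (\<Union>l. inst (\<lambda>j. s l (b j)) ` \<pi>)" using F by auto
    ultimately obtain \<rho> where "\<forall>\<psi>\<in>?F. models R \<rho> \<psi>" unfolding consistent_def by blast
    then show False using inconsistent[of \<rho>] by blast
  qed
  ultimately show ?thesis unfolding divides_def by blast
qed

lemma (in henson) divides_if_forces_eq:
  assumes small: "small \<kappa> (b ` J)" "small \<kappa> C" and j: "j \<in> J" "b j \<notin> C"
    and \<phi>: "\<phi> \<in> \<pi>" "\<And>\<rho> b'. models R \<rho> (inst b' \<phi>) \<Longrightarrow> \<rho> i = b' j"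
  shows "divides R C J \<pi> b"
proof -
  have "\<not> Kn R n {} C" by (simp add: Kn_def)
  then obtain s where s: "crossed_copies R {} C (b ` J \<union> C) s"
    using crossed_copies_exist[of "b ` J \<union> C" C "{}"] small_Un[OF small] n_pos by auto
  show ?thesis
  proof (rule divides_if_crossed_copies[OF s, of "{\<phi>}" _ 2])
    fix \<rho> assume realization: "\<And>l \<psi>. l < 2 \<Longrightarrow> \<psi> \<in> {\<phi>} \<Longrightarrow> models R \<rho> (inst (\<lambda>j. s l (b j)) \<psi>)"
    have "\<rho> i = s l (b j)" if "l < 2" for l using \<phi>(2)[OF realization] that by simp
    from this[of 0] this[of 1] have "s 0 (b j) = s 1 (b j)" by simp
    then show False using crossed_copiesD(2)[OF s, of "b j" "b j" 0 1] j by simp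
  qed (use \<phi>(1) in auto)
qed

text \<open>
  In copies crossed along \<open>X\<close>, the points of \<open>X\<close> taken from distinct copies form a clique, so that
  nothing can complete all the copies of \<open>X\<close> to cliques of size \<open>n\<close> at once.
\<close>

lemma (in henson) divides_if_forces_Kn_pair:
  fixes \<tau> :: "('i \<Rightarrow> 'a) \<Rightarrow> 'a \<Rightarrow> 'a"
  assumes small: "small \<kappa> (b ` J)" "small \<kappa> C"
    and XT: "Kn_pair R n X T" "X \<subseteq> b ` J - C" "\<not> Kn R n X C"
    and F: "finite F" "F \<subseteq> \<pi>"
    and forced: "\<And>\<rho> f. embedding R R (b ` J \<union> C) f \<Longrightarrow> (\<And>c. c \<in> C \<Longrightarrow> f c = c) \<Longrightarrow>
      (\<And>\<phi>. \<phi> \<in> F \<Longrightarrow> models R \<rho> (inst (\<lambda>j. f (b j)) \<phi>)) \<Longrightarrow>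
      \<exists>h. (\<forall>x\<in>X \<union> T. \<forall>y\<in>X \<union> T. R x y \<longrightarrow> R (h x) (h y)) \<and>
        (\<forall>x\<in>X. h x = f x) \<and> (\<forall>t\<in>T. h t = \<tau> \<rho> t)"
  shows "divides R C J \<pi> b"
proof -
  have X: "finite X" "0 < card X" "card X < n"
    using XT(1) card_less_if_Kn_pair by (auto simp: Kn_pair_def)
  then obtain s where s: "crossed_copies R X C (b ` J \<union> C) s"
    using crossed_copies_exist[of "b ` J \<union> C" C X] small_Un[OF small] XT(2,3) by blast
  obtain e where e: "bij_betw e X {0..<card X}" using ex_bij_betw_finite_nat[OF X(1)] by blast
  show ?thesis
  proof (rule divides_if_crossed_copies[OF s F, of "card X"])
    fix \<rho> assume realization: "\<And>l \<phi>. l < card X \<Longrightarrow> \<phi> \<in> F \<Longrightarrow> models R \<rho> (inst (\<lambda>j. s l (b j)) \<phi>)"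
    have joined: "pairwise (\<lambda>u v. R (\<tau> \<rho> u) (\<tau> \<rho> v)) T \<and> (\<forall>x\<in>X. \<forall>t\<in>T. R (s l x) (\<tau> \<rho> t))"
      if l: "l < card X" for l
    proof -
      obtain h where h: "\<forall>x\<in>X \<union> T. \<forall>y\<in>X \<union> T. R x y \<longrightarrow> R (h x) (h y)"
        and h_eq: "\<forall>x\<in>X. h x = s l x" "\<forall>t\<in>T. h t = \<tau> \<rho> t"
        using forced[OF crossed_copies_embedding[OF s] crossed_copiesD(4)[OF s] realization[OF l]]
        by auto
      have "pairwise (\<lambda>u v. R (h u) (h v)) T" "\<And>x t. x \<in> X \<Longrightarrow> t \<in> T \<Longrightarrow> R (h x) (h t)"
        using Kn_pair_homomorphism[OF XT(1), of R h] h by blast+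
      then show ?thesis using h_eq by (simp add: pairwise_def)
    qed
    have "pairwise (\<lambda>x y. R (s (e x) x) (s (e y) y)) X"
      by (rule crossed_copies_transversal[OF s]) (use XT(2) e in \<open>auto simp: bij_betw_def\<close>)
    moreover have "R (s (e x) x) (\<tau> \<rho> t)" if "x \<in> X" "t \<in> T" for x t
      using joined bij_betwE[OF e] that by simp
    ultimately show False
      using Kn_pair_not_clique_image[OF XT(1), of "\<lambda>x. s (e x) x" "\<tau> \<rho>"] joined[OF X(2)] by blast
  qed
qed

section \<open>Generic realizations\<close>

lemma holds_conjuncts: "holds R \<rho> e \<phi> \<longleftrightarrow> (\<forall>\<psi>\<in>conjuncts \<phi>. holds R \<rho> e \<psi>)"
  by (induction \<phi>) auto

lemma wf_fm_conjunct: "\<psi> \<in> conjuncts \<phi> \<Longrightarrow> wf_fm k \<phi> \<Longrightarrow> wf_fm k \<psi>"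
  by (induction \<phi>) auto

lemma syms_conjunct: "\<psi> \<in> conjuncts \<phi> \<Longrightarrow> syms \<psi> \<subseteq> syms \<phi>"
  by (induction \<phi>) auto

lemma L0_literalE:
  assumes \<phi>: "\<phi> \<in> L0 k m C" and \<psi>: "\<psi> \<in> conjuncts \<phi>"
  obtains (Eq) s t where "\<psi> = Eq (Sym s) (Sym t)" "{s, t} \<subseteq> ({..<k} <+> {..<m}) <+> C"
    | (Adj) s t where "\<psi> = Adj (Sym s) (Sym t)" "{s, t} \<subseteq> ({..<k} <+> {..<m}) <+> C"
    | (Neg_Eq) s t where "\<psi> = Neg (Eq (Sym s) (Sym t))" "{s, t} \<subseteq> ({..<k} <+> {..<m}) <+> C"
    | (Neg_Adj) s t where "\<psi> = Neg (Adj (Sym s) (Sym t))" "{s, t} \<subseteq> ({..<k} <+> {..<m}) <+> C"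
proof -
  have wf: "wf_fm 0 \<psi>" "syms \<psi> \<subseteq> ({..<k} <+> {..<m}) <+> C" and "literal \<psi>"
    using \<phi> wf_fm_conjunct[OF \<psi>] syms_conjunct[OF \<psi>] \<psi> by (auto simp: L0_def lang_def)
  then obtain s t where st: "\<psi> \<in> {Eq s t, Adj s t, Neg (Eq s t), Neg (Adj s t)}"
    unfolding literal_def by blast
  then have "wf_tm 0 s" "wf_tm 0 t" using wf(1) by auto
  then obtain u v where "s = Sym u" "t = Sym v" by (cases s; cases t) auto
  then show thesis using st wf(2) that by auto
qed

text \<open>
  Elements of the structure are on the left, the variables \<open>x\<^sub>i\<close> on the right; the latter have only
  the edges that \<open>\<phi>(x,b)\<close> prescribes.
\<close>

definition prescribed_vertex :: "'a list \<Rightarrow> (nat + nat) + 'a \<Rightarrow> 'a + nat" where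
  "prescribed_vertex bs = case_sum (case_sum Inr (\<lambda>j. Inl (bs ! j))) Inl"

definition prescribed_graph ::
  "('a \<Rightarrow> 'a \<Rightarrow> bool) \<Rightarrow> 'a list \<Rightarrow> ((nat + nat) + 'a) fm \<Rightarrow> 'a + nat \<Rightarrow> 'a + nat \<Rightarrow> bool" where
  "prescribed_graph R bs \<phi> u v \<longleftrightarrow>
     (\<exists>d d'. u = Inl d \<and> v = Inl d' \<and> R d d') \<or>
     (\<exists>s t. u = prescribed_vertex bs s \<and> v = prescribed_vertex bs t \<and>
        Adj (Sym s) (Sym t) \<in> conjuncts \<phi>)"

lemma prescribed_vertex_value: "case_sum id \<rho> (prescribed_vertex bs s) = assign \<rho> (nth bs) s"
  by (simp add: prescribed_vertex_def split: sum.split)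

lemma prescribed_graph_homomorphism:
  assumes "models R \<rho> (inst (nth bs) \<phi>)" "prescribed_graph R bs \<phi> u v"
  shows "R (case_sum id \<rho> u) (case_sum id \<rho> v)"
proof -
  have "R (assign \<rho> (nth bs) s) (assign \<rho> (nth bs) t)"
    if "Adj (Sym s) (Sym t) \<in> conjuncts \<phi>" for s t
    using assms(1) that holds_conjuncts[of R _ "[]" \<phi>] unfolding models_inst by force
  then show ?thesis
    using assms(2) by (auto simp: prescribed_graph_def prescribed_vertex_value)
qed

lemma prescribed_graph_Inl_iff:
  assumes "models R \<rho> (inst (nth bs) \<phi>)"
  shows "prescribed_graph R bs \<phi> (Inl d) (Inl d') \<longleftrightarrow> R d d'"
  using prescribed_graph_homomorphism[OF assms, of "Inl d" "Inl d'"]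
  by (auto simp: prescribed_graph_def)

lemma graph_prescribed_graph:
  assumes R: "graph R" and \<phi>: "sym_closed \<phi>" and \<rho>: "models R \<rho> (inst (nth bs) \<phi>)"
  shows "graph (prescribed_graph R bs \<phi>)"
  unfolding graph_def
proof (intro conjI allI impI notI)
  show "prescribed_graph R bs \<phi> v u" if "prescribed_graph R bs \<phi> u v" for u v
    using that R \<phi> unfolding prescribed_graph_def graph_def sym_closed_def by blast
  show False if "prescribed_graph R bs \<phi> u u" for u
    using prescribed_graph_homomorphism[OF \<rho> that] R by (simp add: graph_def)
qed

lemma LR_Eq_same_vertex:
  assumes \<phi>: "\<phi> \<in> LR k m C" and Eq: "Eq (Sym s) (Sym t) \<in> conjuncts \<phi>"
    and val: "assign \<rho> (nth bs) s = assign \<rho> (nth bs) t"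
  shows "prescribed_vertex bs s = prescribed_vertex bs t"
proof -
  have Eq_swap: "Eq (Sym t) (Sym s) \<in> conjuncts \<phi>"
    using \<phi> Eq by (simp add: LR_def L0_def sym_closed_def)
  have excluded: "Eq (Sym (Inl v)) (Sym (Inr c)) \<notin> conjuncts \<phi>" "Eq (xvar i) (yvar j) \<notin> conjuncts \<phi>"
    for v c i j
    using \<phi> by (auto simp: LR_def L0_def)
  have same_variable: "i = j" if "Eq (xvar i) (xvar j) \<in> conjuncts \<phi>" for i j
    using \<phi> that by (auto simp: LR_def L0_def)
  show ?thesis
    using Eq Eq_swap excluded val
    by (auto simp: prescribed_vertex_def dest: same_variable split: sum.splits)
qed

lemma models_if_prescribed_embedding:
  assumes \<phi>: "\<phi> \<in> LR k m C" and \<rho>: "models R \<rho> (inst (nth bs) \<phi>)"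
    and f: "embedding (prescribed_graph R bs \<phi>) R V f"
    and image: "\<And>s. s \<in> ({..<k} <+> {..<m}) <+> C \<Longrightarrow>
      prescribed_vertex bs s \<in> V \<and> assign a (nth bs) s = f (prescribed_vertex bs s)"
  shows "models R a (inst (nth bs) \<phi>)"
  unfolding models_inst holds_conjuncts[of R _ _ \<phi>]
proof
  fix \<psi> assume \<psi>: "\<psi> \<in> conjuncts \<phi>"
  let ?v = "prescribed_vertex bs" and ?a = "assign a (nth bs)" and ?\<rho> = "assign \<rho> (nth bs)"
  have holds: "holds R ?\<rho> [] \<psi>" using \<rho> \<psi> holds_conjuncts unfolding models_inst by blast
  have eq: "?a s = ?a t \<longleftrightarrow> ?v s = ?v t"
    and adj: "R (?a s) (?a t) \<longleftrightarrow> prescribed_graph R bs \<phi> (?v s) (?v t)"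
    if "{s, t} \<subseteq> ({..<k} <+> {..<m}) <+> C" for s t
    using image[of s] image[of t] that embeddingD[OF f] by auto
  have "\<phi> \<in> L0 k m C" using \<phi> by (simp add: LR_def)
  then show "holds R ?a [] \<psi>"
    using \<psi>
  proof (cases rule: L0_literalE)
    case (Eq s t)
    then show ?thesis using LR_Eq_same_vertex[OF \<phi>] \<psi> holds eq by simp
  next
    case (Adj s t)
    then show ?thesis using \<psi> adj by (auto simp: prescribed_graph_def)
  next
    case (Neg_Eq s t)
    then have "?v s \<noteq> ?v t" using holds by (auto simp flip: prescribed_vertex_value)
    then show ?thesis using Neg_Eq eq by simp
  next
    case (Neg_Adj s t)
    then have "\<not> prescribed_graph R bs \<phi> (?v s) (?v t)"
      using holds prescribed_graph_homomorphism[OF \<rho>] by (auto simp flip: prescribed_vertex_value)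
    then show ?thesis using Neg_Adj adj by simp
  qed
qed

definition generic_realization ::
  "('a \<Rightarrow> 'a \<Rightarrow> bool) \<Rightarrow> nat \<Rightarrow> ((nat + nat) + 'a) fm \<Rightarrow> 'a list \<Rightarrow> 'a set \<Rightarrow> (nat \<Rightarrow> 'a) \<Rightarrow> bool" where
  "generic_realization R k \<phi> bs C a \<longleftrightarrow>
     models R a (inst (nth bs) \<phi>) \<and> inj_on a {..<k} \<and> a ` {..<k} \<inter> (set bs \<union> C) = {} \<and>
     (\<forall>i<k. \<forall>y \<in> a ` {..<k} \<union> set bs \<union> C. R (a i) y \<longrightarrow>
       (\<exists>t \<in> ({..<k} <+> {..<length bs}) <+> C.
          assign a (nth bs) t = y \<and> Adj (xvar i) (Sym t) \<in> conjuncts \<phi>))"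

text \<open>
  A clique in the prescribed graph maps to a clique of the given realization \<open>\<rho>\<close>.
\<close>

lemma (in henson) generic_realization_exists:
  assumes small: "small \<kappa> C" and \<phi>: "\<phi> \<in> LR k (length bs) C" and \<rho>: "models R \<rho> (inst (nth bs) \<phi>)"
  obtains a where "generic_realization R k \<phi> bs C a"
proof -
  let ?E = "prescribed_graph R bs \<phi>" and ?v = "prescribed_vertex bs" and ?D = "set bs \<union> C"
    and ?S = "({..<k} <+> {..<length bs}) <+> C"
  let ?V = "Inl ` ?D \<union> Inr ` {..<k}"
  have "graph ?E" using graph \<phi> \<rho> by (intro graph_prescribed_graph) (simp_all add: LR_def L0_def)
  moreover have "clique_free n ?V ?E"
    using prescribed_graph_homomorphism[OF \<rho>] by (rule clique_free_if_homomorphism)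
  moreover have "small \<kappa> ?V" by (intro small_Un small_image small small_finite) auto
  moreover have "embedding ?E R (Inl ` ?D) projl"
    by (auto simp: embedding_def inj_on_def prescribed_graph_Inl_iff[OF \<rho>])
  ultimately obtain f where f: "embedding ?E R ?V f" and f_Inl: "\<And>v. v \<in> Inl ` ?D \<Longrightarrow> f v = projl v"
    using embedding_extension[of ?V "Inl ` ?D" ?E projl] by blast
  define a where "a i = f (Inr i)" for i
  have S: "?v s \<in> ?V \<and> assign a (nth bs) s = f (?v s)" if "s \<in> ?S" for s
    using that f_Inl by (auto simp: prescribed_vertex_def a_def)
  have "models R a (inst (nth bs) \<phi>)" using \<phi> \<rho> f S by (rule models_if_prescribed_embedding)
  moreover have "inj_on a {..<k}" using embedding_eq_iff[OF f] by (auto simp: inj_on_def a_def)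
  moreover have "a i \<noteq> d" if "i < k" "d \<in> ?D" for i d
    using embedding_eq_iff[OF f, of "Inr i" "Inl d"] f_Inl[of "Inl d"] that by (auto simp: a_def)
  then have "a ` {..<k} \<inter> ?D = {}" by blast
  moreover have "\<exists>t\<in>?S. assign a (nth bs) t = y \<and> Adj (xvar i) (Sym t) \<in> conjuncts \<phi>"
    if i: "i < k" and y: "y \<in> a ` {..<k} \<union> set bs \<union> C" "R (a i) y" for i y
  proof -
    have "y \<in> f ` ?V" using y(1) f_Inl by (force simp: a_def)
    then obtain v where v: "v \<in> ?V" "y = f v" by blast
    then have "?E (Inr i) v" using embedding_adj_iff[OF f, of "Inr i" v] i y(2) by (simp add: a_def)
    then obtain s t where st: "?v s = Inr i" "?v t = v" "Adj (Sym s) (Sym t) \<in> conjuncts \<phi>"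
      by (auto simp: prescribed_graph_def)
    have "s = Inl (Inl i)" using st(1) by (auto simp: prescribed_vertex_def split: sum.splits)
    moreover have "t \<in> ?S"
      using syms_conjunct[OF st(3)] \<phi> by (auto simp: LR_def L0_def lang_def)
    ultimately show ?thesis using st S v(2) by auto
  qed
  ultimately have "generic_realization R k \<phi> bs C a" unfolding generic_realization_def by blast
  then show thesis by (rule that)
qed

text \<open>
  Every realization of \<open>\<phi>(x,f b)\<close> is a homomorphic image of a generic realization of \<open>\<phi>(x,b)\<close>,
  which therefore decides \<open>Kn_phi\<close> alone.
\<close>

definition realization_map :: "(nat \<Rightarrow> 'a) \<Rightarrow> nat \<Rightarrow> (nat \<Rightarrow> 'a) \<Rightarrow> ('a \<Rightarrow> 'a) \<Rightarrow> 'a \<Rightarrow> 'a" where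
  "realization_map a k \<rho> f x = (if x \<in> a ` {..<k} then \<rho> (inv_into {..<k} a x) else f x)"

lemma realization_map_variable:
  "inj_on a {..<k} \<Longrightarrow> i < k \<Longrightarrow> realization_map a k \<rho> f (a i) = \<rho> i"
  by (simp add: realization_map_def)

lemma realization_map_outside: "x \<notin> a ` {..<k} \<Longrightarrow> realization_map a k \<rho> f x = f x"
  by (simp add: realization_map_def)

lemma (in clique_free_graph) realization_map_homomorphism:
  assumes a: "generic_realization R k \<phi> bs C a"
    and f: "embedding R R (set bs \<union> C) f" "\<And>c. c \<in> C \<Longrightarrow> f c = c"
    and \<rho>: "models R \<rho> (inst (\<lambda>j. f (bs ! j)) \<phi>)"
    and xy: "x \<in> a ` {..<k} \<union> set bs \<union> C" "y \<in> a ` {..<k} \<union> set bs \<union> C" "R x y"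
  shows "R (realization_map a k \<rho> f x) (realization_map a k \<rho> f y)"
proof -
  let ?h = "realization_map a k \<rho> f"
  have inj: "inj_on a {..<k}" and disj: "a ` {..<k} \<inter> (set bs \<union> C) = {}"
    using a by (auto simp: generic_realization_def)
  have outside: "?h d = f d" if "d \<in> set bs \<union> C" for d
    using disj that by (intro realization_map_outside) blast
  have h_assign: "?h (assign a (nth bs) t) = assign \<rho> (\<lambda>j. f (bs ! j)) t"
    if "t \<in> ({..<k} <+> {..<length bs}) <+> C" for t
    using that f(2) outside realization_map_variable[OF inj] by (auto elim!: PlusE)
  have variable: "R (?h (a i)) (?h y)"
    if i: "i < k" and y: "y \<in> a ` {..<k} \<union> set bs \<union> C" "R (a i) y" for i y
  proof -
    obtain t where t: "t \<in> ({..<k} <+> {..<length bs}) <+> C" "assign a (nth bs) t = y"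
      "Adj (xvar i) (Sym t) \<in> conjuncts \<phi>"
      using a i y unfolding generic_realization_def by blast
    have "holds R (assign \<rho> (\<lambda>j. f (bs ! j))) [] (Adj (xvar i) (Sym t))"
      using \<rho> t(3) holds_conjuncts unfolding models_inst by blast
    then show ?thesis using h_assign[OF t(1)] realization_map_variable[OF inj i] t(2) by simp
  qed
  consider "x \<in> a ` {..<k}" | "y \<in> a ` {..<k}" | "x \<in> set bs \<union> C" "y \<in> set bs \<union> C" using xy by blast
  then show ?thesis
  proof cases
    assume "x \<in> a ` {..<k}"
    then show ?thesis using variable xy by blast
  next
    assume "y \<in> a ` {..<k}"
    then show ?thesis using variable[THEN adj_sym] adj_sym[OF xy(3)] xy(1) by blast
  next
    assume D: "x \<in> set bs \<union> C" "y \<in> set bs \<union> C"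
    then show ?thesis using embedding_adj_iff[OF f(1) D] xy(3) outside by simp
  qed
qed

lemma (in clique_free_graph) Kn_if_generic_Kn_pair:
  assumes a: "generic_realization R k \<phi> bs C a"
    and XT: "Kn_pair R n X T" "X \<subseteq> set bs" "T \<subseteq> a ` {..<k} \<union> C"
    and as: "length as = k" "models R (nth as) (inst (nth bs) \<phi>)"
  shows "Kn R n X ((set as \<union> C) - X)"
proof (rule Kn_if_Kn_pair)
  let ?h = "realization_map a k (nth as) id"
  have hom: "R (?h x) (?h y)" if "x \<in> X \<union> T" "y \<in> X \<union> T" "R x y" for x y
    by (rule realization_map_homomorphism[OF a])
      (use XT(2,3) as(2) that in \<open>auto simp: embedding_def\<close>)
  have "?h x = x" if "x \<in> X" for x
    using that XT(2) a by (subst realization_map_outside) (auto simp: generic_realization_def)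
  then have join: "R x (?h t)" if "x \<in> X" "t \<in> T" for x t
    using Kn_pair_homomorphism(2)[OF XT(1), of R ?h, OF hom that] that by simp
  show "Kn_pair R n X (?h ` T)"
    using XT(1) Kn_pair_homomorphism(1)[OF XT(1), of R ?h, OF hom] join by (rule Kn_pair_image)
  have "?h t \<in> set as \<union> C" if "t \<in> T" for t
    using that XT(3) as(1) inv_into_into[of t a "{..<k}"] by (auto simp: realization_map_def)
  moreover have "?h t \<notin> X" if "t \<in> T" for t using join that adj_irrefl by blast
  ultimately show "?h ` T \<subseteq> (set as \<union> C) - X" by blast
qed auto

lemma (in henson) Kn_phi_iff_generic:
  assumes a: "generic_realization R k \<phi> bs C a" and \<phi>: "\<phi> \<in> LR k (length bs) C"
    and bs: "set bs \<inter> C = {}"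
  shows "Kn_phi R n k \<phi> bs C \<longleftrightarrow>
    (\<exists>X\<subseteq>set bs. \<exists>T\<subseteq>a ` {..<k} \<union> C. Kn_pair R n X T \<and> \<not> Kn R n X C)"
proof
  have disj: "a ` {..<k} \<inter> (set bs \<union> C) = {}" and model: "models R a (inst (nth bs) \<phi>)"
    using a by (auto simp: generic_realization_def)
  assume "Kn_phi R n k \<phi> bs C"
  then obtain B where B: "B \<subseteq> set bs" "\<not> Kn R n B C" and
    Kn: "\<And>as. length as = k \<Longrightarrow> models R (nth as) (inst (nth bs) \<phi>) \<Longrightarrow> Kn R n B ((set as \<union> C) - B)"
    unfolding Kn_phi_def by blast
  have "models R (nth (map a [0..<k])) (inst (nth bs) \<phi>)"
    by (rule iffD1[OF models_inst_embedding[where f = id and V = UNIV] model])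
      (use \<phi> in \<open>auto simp: LR_def L0_def embedding_def\<close>)
  from Kn[OF _ this] have "Kn R n B ((a ` {..<k} \<union> C) - B)" by (simp add: lessThan_atLeast0)
  moreover have "(a ` {..<k} \<union> C) - B = a ` {..<k} \<union> C" and B_disj: "B \<inter> (a ` {..<k} \<union> C) = {}"
    using B(1) disj bs by blast+
  ultimately have "Kn R n B (a ` {..<k} \<union> C)" by simp
  then obtain X T where
    XT: "Kn_pair R n X T" "X \<subseteq> B" "T \<subseteq> a ` {..<k} \<union> C" "\<not> Kn R n X C"
    by (rule Kn_pair_not_KnE[OF _ B(2) B_disj Un_upper2])
  then have "X \<subseteq> set bs" using B(1) by blast
  then show "\<exists>X\<subseteq>set bs. \<exists>T\<subseteq>a ` {..<k} \<union> C. Kn_pair R n X T \<and> \<not> Kn R n X C"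
    using XT by blast
next
  assume "\<exists>X\<subseteq>set bs. \<exists>T\<subseteq>a ` {..<k} \<union> C. Kn_pair R n X T \<and> \<not> Kn R n X C"
  then obtain X T where XT: "Kn_pair R n X T" "X \<subseteq> set bs" "T \<subseteq> a ` {..<k} \<union> C" "\<not> Kn R n X C"
    by blast
  then show "Kn_phi R n k \<phi> bs C"
    using card_less_if_Kn_pair[OF XT(1)] Kn_if_generic_Kn_pair[OF a XT(1-3)]
    unfolding Kn_phi_def by blast
qed

section \<open>Dividing of formulas and of types\<close>

context henson
begin

lemma divides_if_conjunct_eq:
  assumes small: "small \<kappa> C" and bs: "set bs \<inter> C = {}" and eq: "has_conjunct_eq \<phi> bs i b"
  shows "divides R C {..<length bs} {\<phi>} (nth bs)"
proof -
  obtain j where j: "j < length bs" "Eq (xvar i) (yvar j) \<in> conjuncts \<phi>"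
    using eq unfolding has_conjunct_eq_def by blast
  show ?thesis
  proof (rule divides_if_forces_eq)
    show "bs ! j \<notin> C" using bs nth_mem[OF j(1)] by blast
    fix \<rho> b' assume "models R \<rho> (inst b' \<phi>)"
    then have "holds R (assign \<rho> b') [] (Eq (xvar i) (yvar j))"
      using j(2) holds_conjuncts unfolding models_inst by blast
    then show "\<rho> i = b' j" by simp
  qed (use small j(1) in \<open>auto intro: small_finite\<close>)
qed

lemma Kn_phi_if_divides:
  assumes small: "small \<kappa> C" and bs: "set bs \<inter> C = {}" and \<phi>: "\<phi> \<in> LR k (length bs) C"
    and a: "generic_realization R k \<phi> bs C a"
    and divides: "divides R C {..<length bs} {\<phi>} (nth bs)"
  shows "Kn_phi R n k \<phi> bs C"
proof (rule ccontr)
  let ?A = "a ` {..<k}"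
  have disj: "?A \<inter> (set bs \<union> C) = {}" and model: "models R a (inst (nth bs) \<phi>)"
    using a by (auto simp: generic_realization_def)
  have nth_image: "nth bs ` {..<length bs} = set bs" by (auto simp: set_conv_nth)
  assume "\<not> Kn_phi R n k \<phi> bs C"
  then have no_pair: "Kn R n X C" if "X \<subseteq> set bs" "T \<subseteq> ?A \<union> C" "Kn_pair R n X T" for X T
    using that unfolding Kn_phi_iff_generic[OF a \<phi> bs] by blast
  have "\<not> divides R C {..<length bs} {\<phi>} (nth bs)"
  proof (rule not_divides_if_Kn)
    show "?A \<inter> nth bs ` {..<length bs} \<subseteq> C" unfolding nth_image using disj by blast
    show "{\<phi>} \<subseteq> lang ({..<k} <+> {..<length bs}) C" using \<phi> by (simp add: LR_def L0_def)
    fix X assume X: "X \<subseteq> nth bs ` {..<length bs} - C" "Kn R n X (?A \<union> C)"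
    then have "X \<subseteq> set bs" "X \<inter> (?A \<union> C) = {}" using disj unfolding nth_image by blast+
    then show "Kn R n X C" using no_pair Kn_pair_not_KnE[OF X(2)] by (metis Un_upper2 subset_trans)
  qed (use small model in \<open>auto intro: small_finite\<close>)
  then show False using divides by blast
qed

lemma divides_if_Kn_phi:
  assumes small: "small \<kappa> C" and bs: "set bs \<inter> C = {}" and \<phi>: "\<phi> \<in> LR k (length bs) C"
    and a: "generic_realization R k \<phi> bs C a" and Kn_phi: "Kn_phi R n k \<phi> bs C"
  shows "divides R C {..<length bs} {\<phi>} (nth bs)"
proof -
  have disj: "a ` {..<k} \<inter> (set bs \<union> C) = {}" using a by (simp add: generic_realization_def)
  have nth_image: "nth bs ` {..<length bs} = set bs" by (auto simp: set_conv_nth)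
  obtain X T where XT: "Kn_pair R n X T" "X \<subseteq> set bs" "T \<subseteq> a ` {..<k} \<union> C" "\<not> Kn R n X C"
    using Kn_phi unfolding Kn_phi_iff_generic[OF a \<phi> bs] by blast
  show ?thesis
  proof (rule divides_if_forces_Kn_pair[OF _ small XT(1) _ XT(4), of _ _ "{\<phi>}"
        _ "\<lambda>\<rho>. realization_map a k \<rho> id"])
    show "X \<subseteq> nth bs ` {..<length bs} - C" unfolding nth_image using XT(2) bs by blast
    fix \<rho> f
    let ?h = "realization_map a k \<rho> f"
    assume f: "embedding R R (nth bs ` {..<length bs} \<union> C) f" "\<And>c. c \<in> C \<Longrightarrow> f c = c"
      and \<rho>: "\<And>\<psi>. \<psi> \<in> {\<phi>} \<Longrightarrow> models R \<rho> (inst (\<lambda>j. f (bs ! j)) \<psi>)"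
    have "R (?h x) (?h y)" if "x \<in> X \<union> T" "y \<in> X \<union> T" "R x y" for x y
      by (rule realization_map_homomorphism[OF a])
        (use f[unfolded nth_image] \<rho> XT(2,3) that in auto)
    moreover have "?h x = f x" if "x \<in> X" for x
      using that XT(2) disj by (intro realization_map_outside) blast
    moreover have "?h t = realization_map a k \<rho> id t" if "t \<in> T" for t
      using that XT(3) f(2) by (auto simp: realization_map_def)
    ultimately show "\<exists>h. (\<forall>x\<in>X \<union> T. \<forall>y\<in>X \<union> T. R x y \<longrightarrow> R (h x) (h y)) \<and>
      (\<forall>x\<in>X. h x = f x) \<and> (\<forall>t\<in>T. h t = realization_map a k \<rho> id t)"
      by (intro exI[of _ ?h]) blast
  qed (auto intro: small_finite)
qed

lemma formula_divides_iff:
  assumes small: "small \<kappa> C" and bs: "set bs \<inter> C = {}" and \<phi>: "\<phi> \<in> L0 k (length bs) C"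
    and "consistent R {inst (nth bs) \<phi>}"
  shows "divides R C {..<length bs} {\<phi>} (nth bs) \<longleftrightarrow>
    (\<exists>i. \<exists>b\<in>set bs. has_conjunct_eq \<phi> bs i b) \<or> (\<phi> \<in> LR k (length bs) C \<and> Kn_phi R n k \<phi> bs C)"
proof (cases "\<phi> \<in> LR k (length bs) C")
  case True
  obtain \<rho> where "models R \<rho> (inst (nth bs) \<phi>)" using assms(4) unfolding consistent_def by blast
  then obtain a where a: "generic_realization R k \<phi> bs C a"
    by (rule generic_realization_exists[OF small True])
  have "\<not> has_conjunct_eq \<phi> bs i b" for i b using True by (simp add: LR_def has_conjunct_eq_def)
  then show ?thesis
    using Kn_phi_if_divides[OF small bs True a] divides_if_Kn_phi[OF small bs True a] True by blast
next
  case False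
  then obtain i j where eq: "Eq (xvar i) (yvar j) \<in> conjuncts \<phi>" using \<phi> by (auto simp: LR_def)
  then have j: "j < length bs" using syms_conjunct[OF eq] \<phi> by (auto simp: L0_def lang_def)
  then have "has_conjunct_eq \<phi> bs i (bs ! j)" using eq by (auto simp: has_conjunct_eq_def)
  then show ?thesis using divides_if_conjunct_eq[OF small bs] nth_mem[OF j] by blast
qed

end

definition full_type :: "('a \<Rightarrow> 'a \<Rightarrow> bool) \<Rightarrow> 'a set \<Rightarrow> 'a set \<Rightarrow> (('a + 'a) + 'a) fm set" where
  "full_type R A D = {\<phi> \<in> lang (A <+> D) {}. inst id \<phi> \<in> tp R A D}"

lemma indep_d_iff_full_type:
  "indep_d R A C B \<longleftrightarrow> \<not> divides R C (B \<union> C) (full_type R A (B \<union> C)) id"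
  by (simp add: indep_d_def full_type_def)

lemma wf_fm_map_fm: "wf_fm k (map_fm f \<phi>) \<longleftrightarrow> wf_fm k \<phi>"
proof (induction \<phi> arbitrary: k)
  have "wf_tm k (map_tm f t) \<longleftrightarrow> wf_tm k t" for k t by (cases t) auto
  then show "wf_fm k (map_fm f (Eq s t)) \<longleftrightarrow> wf_fm k (Eq s t)"
    "wf_fm k (map_fm f (Adj s t)) \<longleftrightarrow> wf_fm k (Adj s t)" for k s t by auto
qed auto

lemma full_type_iff:
  "\<phi> \<in> full_type R A D \<longleftrightarrow> \<phi> \<in> lang (A <+> D) {} \<and> models R id (inst id \<phi>)"
proof -
  have "inst id \<phi> \<in> lang A D" if "\<phi> \<in> lang (A <+> D) {}"
    using that by (auto simp: lang_def inst_def wf_fm_map_fm fm.set_map)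
  then show ?thesis by (auto simp: full_type_def tp_def)
qed

lemma full_type_forces_edges:
  assumes Z: "finite Z" "Z \<subseteq> A \<union> D"
  obtains F where "finite F" "F \<subseteq> full_type R A D"
    "\<And>\<rho> b x y. (\<And>\<phi>. \<phi> \<in> F \<Longrightarrow> models R \<rho> (inst b \<phi>)) \<Longrightarrow> x \<in> Z \<Longrightarrow> y \<in> Z \<Longrightarrow> R x y \<Longrightarrow>
      R (if x \<in> A then \<rho> x else b x) (if y \<in> A then \<rho> y else b y)"
proof
  define name :: "'a \<Rightarrow> ('a + 'a) + 'a" where "name x = Inl (if x \<in> A then Inl x else Inr x)" for x
  define edge where "edge = (\<lambda>(x, y). Adj (Sym (name x)) (Sym (name y)))"
  let ?F = "edge ` {(x, y) \<in> Z \<times> Z. R x y}"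
  have name: "name x \<in> (A <+> D) <+> {}" if "x \<in> Z" for x using that Z(2) by (auto simp: name_def)
  have assign_name: "assign \<rho> b (name x) = (if x \<in> A then \<rho> x else b x)" for \<rho> b x
    by (simp add: name_def)
  show "finite ?F" using Z(1) by (auto intro: finite_subset[of _ "Z \<times> Z"])
  show "?F \<subseteq> full_type R A D"
    using name by (auto simp: edge_def full_type_iff lang_def models_inst assign_name)
  show "R (if x \<in> A then \<rho> x else b x) (if y \<in> A then \<rho> y else b y)"
    if "\<And>\<phi>. \<phi> \<in> ?F \<Longrightarrow> models R \<rho> (inst b \<phi>)" "x \<in> Z" "y \<in> Z" "R x y" for \<rho> b x y
  proof -
    have "models R \<rho> (inst b (edge (x, y)))" using that(2-4) by (intro that(1)) auto
    then show ?thesis by (simp add: edge_def models_inst assign_name)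
  qed
qed

context henson
begin

lemma disjoint_if_indep_d:
  assumes small: "small \<kappa> B" "small \<kappa> C" and indep: "indep_d R A C B"
  shows "A \<inter> B \<subseteq> C"
proof (rule ccontr)
  assume "\<not> A \<inter> B \<subseteq> C"
  then obtain x where x: "x \<in> A" "x \<in> B" "x \<notin> C" by blast
  let ?\<phi> = "Eq (Sym (Inl (Inl x))) (Sym (Inl (Inr x))) :: (('a + 'a) + 'a) fm"
  have "divides R C (B \<union> C) (full_type R A (B \<union> C)) id"
  proof (rule divides_if_forces_eq[where \<phi> = ?\<phi> and i = x and j = x])
    show "?\<phi> \<in> full_type R A (B \<union> C)" using x by (auto simp: full_type_iff lang_def models_inst)
  qed (use x small small_Un in \<open>auto simp: models_inst\<close>)
  then show False using indep by (simp add: indep_d_iff_full_type)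
qed

lemma Kn_if_indep_d:
  assumes small: "small \<kappa> B" "small \<kappa> C" and indep: "indep_d R A C B"
    and Y: "Y \<subseteq> B - C" "Kn R n Y (A \<union> C)"
  shows "Kn R n Y C"
proof (rule ccontr)
  assume not_Kn: "\<not> Kn R n Y C"
  have AB: "A \<inter> B \<subseteq> C" using disjoint_if_indep_d[OF small indep] .
  then have "Y \<inter> (A \<union> C) = {}" using Y(1) by blast
  then obtain X T where XT: "Kn_pair R n X T" "X \<subseteq> Y" "T \<subseteq> A \<union> C" "\<not> Kn R n X C"
    by (rule Kn_pair_not_KnE[OF Y(2) not_Kn _ Un_upper2])
  have "finite (X \<union> T)" "X \<union> T \<subseteq> A \<union> (B \<union> C)" using XT(1-3) Y(1) by (auto simp: Kn_pair_def)
  then obtain F where F: "finite F" "F \<subseteq> full_type R A (B \<union> C)" and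
    edges: "\<And>\<rho> b x y. (\<And>\<phi>. \<phi> \<in> F \<Longrightarrow> models R \<rho> (inst b \<phi>)) \<Longrightarrow> x \<in> X \<union> T \<Longrightarrow> y \<in> X \<union> T \<Longrightarrow> R x y \<Longrightarrow>
      R (if x \<in> A then \<rho> x else b x) (if y \<in> A then \<rho> y else b y)"
    by (rule full_type_forces_edges[where R = R]) blast
  have "divides R C (B \<union> C) (full_type R A (B \<union> C)) id"
  proof (rule divides_if_forces_Kn_pair[OF _ small(2) XT(1) _ XT(4) F,
        where \<tau> = "\<lambda>\<rho> t. if t \<in> A then \<rho> t else t"])
    show "small \<kappa> (id ` (B \<union> C))" using small small_Un by simp
    show "X \<subseteq> id ` (B \<union> C) - C" using XT(2) Y(1) by auto
    fix \<rho> f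
    assume f: "\<And>c. c \<in> C \<Longrightarrow> f c = c" and \<rho>: "\<And>\<phi>. \<phi> \<in> F \<Longrightarrow> models R \<rho> (inst (\<lambda>j. f (id j)) \<phi>)"
    let ?h = "\<lambda>x. if x \<in> A then \<rho> x else f x"
    have "R (?h x) (?h y)" if "x \<in> X \<union> T" "y \<in> X \<union> T" "R x y" for x y
      using edges[of \<rho> f] \<rho> that by simp
    moreover have "?h x = f x" if "x \<in> X" for x using that XT(2) Y(1) AB by auto
    moreover have "?h t = (if t \<in> A then \<rho> t else t)" if "t \<in> T" for t using that XT(3) f by auto
    ultimately show "\<exists>h. (\<forall>x\<in>X \<union> T. \<forall>y\<in>X \<union> T. R x y \<longrightarrow> R (h x) (h y)) \<and>
      (\<forall>x\<in>X. h x = f x) \<and> (\<forall>t\<in>T. h t = (if t \<in> A then \<rho> t else t))"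
      by (intro exI[of _ ?h]) blast
  qed
  then show False using indep by (simp add: indep_d_iff_full_type)
qed

lemma indep_d_if_Kn:
  assumes small: "small \<kappa> A" "small \<kappa> B" "small \<kappa> C" and AB: "A \<inter> B \<subseteq> C"
    and Kn: "\<And>X. finite X \<Longrightarrow> X \<subseteq> B - C \<Longrightarrow> Kn R n X (A \<union> C) \<Longrightarrow> Kn R n X C"
  shows "indep_d R A C B"
  unfolding indep_d_iff_full_type
proof (rule not_divides_if_Kn[where a = id and I = A])
  show "full_type R A (B \<union> C) \<subseteq> lang (A <+> (B \<union> C)) C" by (auto simp: full_type_iff lang_def)
  show "Kn R n X C" if "finite X" "X \<subseteq> id ` (B \<union> C) - C" "Kn R n X (id ` A \<union> C)" for X
    using that by (intro Kn) auto
qed (use small small_Un AB in \<open>auto simp: full_type_iff\<close>)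

lemma indep_d_iff:
  assumes "small \<kappa> A" "small \<kappa> B" "small \<kappa> C"
  shows "indep_d R A C B \<longleftrightarrow> A \<inter> B \<subseteq> C \<and>
    (\<forall>bs. set bs \<subseteq> B - C \<and> Kn R n (set bs) (A \<union> C) \<longrightarrow> Kn R n (set bs) C)"
  using assms disjoint_if_indep_d Kn_if_indep_d indep_d_if_Kn finite_list by metis

end

theorem theorem4p6:
  fixes n :: nat and \<kappa> :: "'k rel" and R :: "'a \<Rightarrow> 'a \<Rightarrow> bool"
  assumes "n \<ge> 3" and "henson_monster n \<kappa> R"
  shows
    "(\<forall>C k bs \<phi>.
        small \<kappa> C \<and> set bs \<inter> C = {} \<and> \<phi> \<in> L0 k (length bs) C \<and>
        consistent R {inst (nth bs) \<phi>} \<longrightarrow>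
          (divides R C {..<length bs} {\<phi>} (nth bs) \<longleftrightarrow>
             (\<exists>i. \<exists>b\<in>set bs. has_conjunct_eq \<phi> bs i b) \<or>
             (\<phi> \<in> LR k (length bs) C \<and> Kn_phi R n k \<phi> bs C))) \<and>
     (\<forall>A B C.
        small \<kappa> A \<and> small \<kappa> B \<and> small \<kappa> C \<longrightarrow>
          (indep_d R A C B \<longleftrightarrow>
             A \<inter> B \<subseteq> C \<and>
             (\<forall>bs. set bs \<subseteq> B - C \<and> Kn R n (set bs) (A \<union> C) \<longrightarrow> Kn R n (set bs) C)))"
proof -
  interpret henson n \<kappa> R using assms(2) by (rule henson_if_monster)
  show ?thesis
    by (intro conjI allI impI; elim conjE) (rule formula_divides_iff indep_d_iff; assumption)+
qed

end
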